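(* The feedback capacity region $\mathcal{C}$ of the two-user Gaussian IC with feedback is contained in the set $\overline{\mathcal{C}}$ of all $(R_1,R_2)$ for which there exists $\rho\in[0,1]$ such that $R_1\le\log(1+\mathsf{SNR}_1+\mathsf{INR}_{21}+2\rho\sqrt{\mathsf{SNR}_1\mathsf{INR}_{21}})$, $R_1\le\log(1+(1-\rho^2)\mathsf{INR}_{12})+\log\left(1+\frac{(1-\rho^2)\mathsf{SNR}_1}{1+(1-\rho^2)\mathsf{INR}_{12}}\right)$, $R_2\le\log(1+\mathsf{SNR}_2+\mathsf{INR}_{12}+2\rho\sqrt{\mathsf{SNR}_2\mathsf{INR}_{12}})$, $R_2\le\log(1+(1-\rho^2)\mathsf{INR}_{21})+\log\left(1+\frac{(1-\rho^2)\mathsf{SNR}_2}{1+(1-\rho^2)\mathsf{INR}_{21}}\right)$, $R_1+R_2\le\log\left(1+\frac{(1-\rho^2)\mathsf{SNR}_1}{1+(1-\rho^2)\mathsf{INR}_{12}}\right)+\log(1+\mathsf{SNR}_2+\mathsf{INR}_{12}+2\rho\sqrt{\mathsf{SNR}_2\mathsf{INR}_{12}})$, $R_1+R_2\le\log\left(1+\frac{(1-\rho^2)\mathsf{SNR}_2}{1+(1-\rho^2)\mathsf{INR}_{21}}\right)+\log(1+\mathsf{SNR}_1+\mathsf{INR}_{21}+2\rho\sqrt{\mathsf{SNR}_1\mathsf{INR}_{21}})$.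
   Context: Two-user Gaussian interference channel (IC) with feedback: for times $i=1,\dots,N$, $Y_{1i}=g_{11}X_{1i}+g_{21}X_{2i}+Z_{1i}$ and $Y_{2i}=g_{12}X_{1i}+g_{22}X_{2i}+Z_{2i}$, where $g_{kl}\in\mathbb{C}$ is the gain from transmitter $k$ to receiver $l$, and the noises $Z_{ki}\sim\mathcal{CN}(0,1)$ are i.i.d. over time, independent across $k$, and independent of the messages. Messages $W_1,W_2$ are independent, $W_k$ uniform on $\{1,\dots,2^{NR_k}\}$. With feedback, the encoder of user $k$ at time $i$ is $X_{ki}=f_k^i(W_k,Y_k^{i-1})$, subject to the power constraint $\frac1N\sum_{i=1}^N\mathbb{E}|X_{ki}|^2\le 1$; receiver $k$ decodes $W_k$ from $Y_k^N$. A rate pair is achievable if there exist such codes with average error probability tending to $0$ as $N\to\infty$; the capacity region $\mathcal{C}$ is the closure of the set of achievable pairs. $\mathsf{SNR}_k=|g_{kk}|^2$, $\mathsf{INR}_{12}=|g_{12}|^2$, $\mathsf{INR}_{21}=|g_{21}|^2$. Logarithms are base 2. *)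

theory Defs
  imports "HOL-Probability.Probability"
begin

text \<open>Conventions. Time indices are 0,...,N-1 (paper's time i+1). Gains: g_kl is the gain
from transmitter k to receiver l, so Y1 = g11 X1 + g21 X2 + Z1, Y2 = g12 X1 + g22 X2 + Z2.
Messages of user k range over 1..M_k with M_k = ceiling(2^(N R_k)).
An encoder is a function (time i) (message w) (past own outputs, restricted to indices < i).
A decoder maps the received block (restricted to indices < N) to a message.\<close>

definition cgauss :: "complex measure" where
  "cgauss = density lborel (\<lambda>z. ennreal (exp (- ((cmod z)^2)) / Transcendental.pi))"

definition noiseM :: "nat \<Rightarrow> (nat \<Rightarrow> complex \<times> complex) measure" where
  "noiseM N = PiM {..<N} (\<lambda>_. cgauss \<Otimes>\<^sub>M cgauss)"

type_synonym encoder = "nat \<Rightarrow> nat \<Rightarrow> (nat \<Rightarrow> complex) \<Rightarrow> complex"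
type_synonym decoder = "(nat \<Rightarrow> complex) \<Rightarrow> nat"

fun hist :: "complex \<Rightarrow> complex \<Rightarrow> complex \<Rightarrow> complex \<Rightarrow> encoder \<Rightarrow> encoder \<Rightarrow>
    nat \<Rightarrow> nat \<Rightarrow> (nat \<Rightarrow> complex \<times> complex) \<Rightarrow> nat \<Rightarrow> (nat \<Rightarrow> complex \<times> complex)" where
  "hist g11 g12 g21 g22 f1 f2 w1 w2 z 0 = (\<lambda>_. (0, 0))"
| "hist g11 g12 g21 g22 f1 f2 w1 w2 z (Suc i) =
     (let h = hist g11 g12 g21 g22 f1 f2 w1 w2 z i;
          x1 = f1 i w1 (restrict (fst \<circ> h) {..<i});
          x2 = f2 i w2 (restrict (snd \<circ> h) {..<i})
      in h(i := (g11 * x1 + g21 * x2 + fst (z i), g12 * x1 + g22 * x2 + snd (z i))))"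

definition tx1 :: "complex \<Rightarrow> complex \<Rightarrow> complex \<Rightarrow> complex \<Rightarrow> encoder \<Rightarrow> encoder \<Rightarrow>
    nat \<Rightarrow> nat \<Rightarrow> (nat \<Rightarrow> complex \<times> complex) \<Rightarrow> nat \<Rightarrow> complex" where
  "tx1 g11 g12 g21 g22 f1 f2 w1 w2 z i =
     f1 i w1 (restrict (fst \<circ> hist g11 g12 g21 g22 f1 f2 w1 w2 z i) {..<i})"

definition tx2 :: "complex \<Rightarrow> complex \<Rightarrow> complex \<Rightarrow> complex \<Rightarrow> encoder \<Rightarrow> encoder \<Rightarrow>
    nat \<Rightarrow> nat \<Rightarrow> (nat \<Rightarrow> complex \<times> complex) \<Rightarrow> nat \<Rightarrow> complex" where
  "tx2 g11 g12 g21 g22 f1 f2 w1 w2 z i =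
     f2 i w2 (restrict (snd \<circ> hist g11 g12 g21 g22 f1 f2 w1 w2 z i) {..<i})"

definition num_msgs :: "nat \<Rightarrow> real \<Rightarrow> nat" where
  "num_msgs N R = nat \<lceil>2 powr (real N * R)\<rceil>"

definition valid_code :: "complex \<Rightarrow> complex \<Rightarrow> complex \<Rightarrow> complex \<Rightarrow> nat \<Rightarrow> real \<Rightarrow> real \<Rightarrow>
    encoder \<Rightarrow> encoder \<Rightarrow> decoder \<Rightarrow> decoder \<Rightarrow> bool" where
  "valid_code g11 g12 g21 g22 N R1 R2 f1 f2 d1 d2 \<longleftrightarrow>
     (\<forall>i w. f1 i w \<in> borel_measurable (PiM {..<i} (\<lambda>_. borel))) \<and>
     (\<forall>i w. f2 i w \<in> borel_measurable (PiM {..<i} (\<lambda>_. borel))) \<and>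
     d1 \<in> measurable (PiM {..<N} (\<lambda>_. borel)) (count_space UNIV) \<and>
     d2 \<in> measurable (PiM {..<N} (\<lambda>_. borel)) (count_space UNIV) \<and>
     (\<Sum>i<N. \<Sum>w1\<in>{1..num_msgs N R1}. \<Sum>w2\<in>{1..num_msgs N R2}.
        \<integral>\<^sup>+ z. ennreal ((cmod (tx1 g11 g12 g21 g22 f1 f2 w1 w2 z i))^2) \<partial>noiseM N)
       \<le> ennreal (real N * real (num_msgs N R1) * real (num_msgs N R2)) \<and>
     (\<Sum>i<N. \<Sum>w1\<in>{1..num_msgs N R1}. \<Sum>w2\<in>{1..num_msgs N R2}.
        \<integral>\<^sup>+ z. ennreal ((cmod (tx2 g11 g12 g21 g22 f1 f2 w1 w2 z i))^2) \<partial>noiseM N)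
       \<le> ennreal (real N * real (num_msgs N R1) * real (num_msgs N R2))"

definition err_prob :: "complex \<Rightarrow> complex \<Rightarrow> complex \<Rightarrow> complex \<Rightarrow> nat \<Rightarrow> real \<Rightarrow> real \<Rightarrow>
    encoder \<Rightarrow> encoder \<Rightarrow> decoder \<Rightarrow> decoder \<Rightarrow> real" where
  "err_prob g11 g12 g21 g22 N R1 R2 f1 f2 d1 d2 =
     (\<Sum>w1\<in>{1..num_msgs N R1}. \<Sum>w2\<in>{1..num_msgs N R2}.
        measure (noiseM N)
          {z \<in> space (noiseM N).
             d1 (restrict (fst \<circ> hist g11 g12 g21 g22 f1 f2 w1 w2 z N) {..<N}) \<noteq> w1 \<or>
             d2 (restrict (snd \<circ> hist g11 g12 g21 g22 f1 f2 w1 w2 z N) {..<N}) \<noteq> w2})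
     / (real (num_msgs N R1) * real (num_msgs N R2))"

definition fb_achievable :: "complex \<Rightarrow> complex \<Rightarrow> complex \<Rightarrow> complex \<Rightarrow> real \<Rightarrow> real \<Rightarrow> bool" where
  "fb_achievable g11 g12 g21 g22 R1 R2 \<longleftrightarrow> 0 \<le> R1 \<and> 0 \<le> R2 \<and>
     (\<exists>F1 F2 D1 D2. (\<forall>N. valid_code g11 g12 g21 g22 N R1 R2 (F1 N) (F2 N) (D1 N) (D2 N)) \<and>
        (\<lambda>N. err_prob g11 g12 g21 g22 N R1 R2 (F1 N) (F2 N) (D1 N) (D2 N)) \<longlonglongrightarrow> 0)"

definition fb_capacity_region :: "complex \<Rightarrow> complex \<Rightarrow> complex \<Rightarrow> complex \<Rightarrow> (real \<times> real) set" where
  "fb_capacity_region g11 g12 g21 g22 =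
     closure {(R1, R2). fb_achievable g11 g12 g21 g22 R1 R2}"

end

(*
A change of measure replaces every entropy computation of the usual converse. Fix the messages and
let P be the law of the two output blocks. For a memoryless-with-feedback Gaussian reference law Q,
the inequality ln x <= x - 1 turns a bound on the total Q-probability of correct decoding into a lower
bound on the averaged divergence of P from Q. Each step of Q generates y2 around a linear
function of the inputs and then y1 around a linear function of the inputs and of y2. If y2 is drawn
independently of the past, the probability of decoding message 2 from y2 does not depend on the
messages, and if the centres do not depend on input 1, the law Q does not depend on message 1. These
two observations bound the total probability of correct decoding for R1, for R2 and directly for
R1 + R2. The centres and variances are the linear least-squares ones for the correlation of the two
inputs, averaged over time and messages; its modulus serves as the single rho for all six bounds. The
other three bounds follow by exchanging the users.
*)

theory Submission
  imports Defs
begin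

section \<open>Circularly symmetric Gaussians\<close>

text \<open>Feedback makes every input a function of past noise, so the output blocks have no
  product structure and an entropy argument would need chain rules for conditional differential
  entropies. With coefficients that are the same at all times and for all messages, the
  log-likelihood is instead a sum of quadratic forms in the inputs and the fresh noise. Its
  expectation is affine in second moments, which are averaged over time and messages before any
  logarithm is taken; hence one \<open>corr\<close> and no concavity argument. The centres of the
  reference law contain the encoders evaluated at the reference outputs, so this law is no product
  either; it is handled as an iterated Lebesgue integral. The converse combines two estimates with
  weight one half each, the total mass of the reference law and its mass on correct decoding. This
  costs \<open>ln 2\<close> per message pair, that is \<open>1 / N\<close> in rate. Finally,
  \<open>corr\<close> depends on the code and may vary with the block length; compactness of [0,1]
  provides a rho for the limiting rates.\<close>

definition cgauss_density :: "real \<Rightarrow> complex \<Rightarrow> real" where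
  "cgauss_density s z = exp (- ((cmod z)\<^sup>2) / s) / (pi * s)"

lemma cgauss_density_pos: "s > 0 \<Longrightarrow> cgauss_density s z > 0"
  by (simp add: cgauss_density_def)

lemma measurable_fst_borel [measurable]:
    "fst \<in> (borel :: ('a::topological_space \<times> 'b::topological_space) measure) \<rightarrow>\<^sub>M borel"
  and measurable_snd_borel [measurable]:
    "snd \<in> (borel :: ('a::topological_space \<times> 'b::topological_space) measure) \<rightarrow>\<^sub>M borel"
  by (intro borel_measurable_continuous_onI continuous_intros)+

lemma cgauss_density_measurable [measurable]: "cgauss_density s \<in> borel_measurable borel"
  unfolding cgauss_density_def by measurable

text \<open>The parameter \<open>s\<close> is the total second moment, so the real and imaginary
  parts carry variance \<open>s / 2\<close> each.\<close>

lemma cgauss_density_normal: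
  assumes "s > 0"
  shows "cgauss_density s z =
    normal_density 0 (sqrt (s / 2)) (Re z) * normal_density 0 (sqrt (s / 2)) (Im z)"
proof -
  have "- (cmod z)\<^sup>2 / s = - (Re z)\<^sup>2 / s + - (Im z)\<^sup>2 / s"
    by (simp add: cmod_power2 diff_divide_distrib)
  then show ?thesis
    using assms by (simp add: cgauss_density_def normal_density_def exp_add[symmetric])
qed

lemma nn_integral_complex_prod:
  fixes f g :: "real \<Rightarrow> ennreal"
  assumes [measurable]: "f \<in> borel_measurable borel" "g \<in> borel_measurable borel"
  shows "(\<integral>\<^sup>+ z. f (Re z) * g (Im z) \<partial>lborel) = (\<integral>\<^sup>+ x. f x \<partial>lborel) * (\<integral>\<^sup>+ x. g x \<partial>lborel)"
  using nn_integral_lborel_prod[where 'a=complex and f="\<lambda>b. if b = 1 then f else g"]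
  by (simp add: Basis_complex_def inner_complex_def)

lemma nn_integral_normal:
  assumes "\<sigma> > 0"
  shows "(\<integral>\<^sup>+ x. ennreal (normal_density 0 \<sigma> x) \<partial>lborel) = 1"
    and "(\<integral>\<^sup>+ x. ennreal (normal_density 0 \<sigma> x * x\<^sup>2) \<partial>lborel) = ennreal (\<sigma>\<^sup>2)"
proof -
  show "(\<integral>\<^sup>+ x. ennreal (normal_density 0 \<sigma> x) \<partial>lborel) = 1"
    using assms by (subst nn_integral_eq_integral) auto
  show "(\<integral>\<^sup>+ x. ennreal (normal_density 0 \<sigma> x * x\<^sup>2) \<partial>lborel) = ennreal (\<sigma>\<^sup>2)"
    using normal_moment_even[OF assms, of 0 1]
    by (subst nn_integral_eq_integral) (auto simp: has_bochner_integral_iff)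
qed

lemma nn_integral_lborel_translate:
  fixes c :: "'a::euclidean_space"
  assumes "f \<in> borel_measurable borel"
  shows "(\<integral>\<^sup>+ x. f (c + x) \<partial>lborel) = (\<integral>\<^sup>+ x. f x \<partial>lborel)"
  using nn_integral_distr[of "(+) c" lborel borel f] assms
  by (simp add: lborel_distr_plus)

lemma nn_integral_cgauss_density:
  assumes "s > 0"
  shows "(\<integral>\<^sup>+ z. ennreal (cgauss_density s (z - c)) \<partial>lborel) = 1"
proof -
  have "(\<integral>\<^sup>+ z. ennreal (cgauss_density s (z - c)) \<partial>lborel) =
        (\<integral>\<^sup>+ z. ennreal (cgauss_density s z) \<partial>lborel)"
    using nn_integral_lborel_translate[of "\<lambda>z. ennreal (cgauss_density s z)" "- c"] by simp
  also have "\<dots> = 1"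
    using assms
    by (simp add: cgauss_density_normal ennreal_mult nn_integral_normal
        nn_integral_complex_prod[of "\<lambda>x. ennreal (normal_density 0 _ x)" "\<lambda>x. ennreal (normal_density 0 _ x)"])
  finally show ?thesis .
qed

lemma cgauss_eq: "cgauss = density lborel (\<lambda>z. ennreal (cgauss_density 1 z))"
  by (simp add: cgauss_def cgauss_density_def)

lemma sets_cgauss [measurable_cong, simp]: "sets cgauss = sets borel"
  by (simp add: cgauss_def)

lemma space_cgauss [simp]: "space cgauss = UNIV"
  by (simp add: cgauss_def)

lemma prob_space_cgauss: "prob_space cgauss"
  using nn_integral_cgauss_density[of 1 0]
  by (intro prob_spaceI) (simp add: cgauss_eq emeasure_density)

lemma emeasure_cgauss [simp]: "emeasure cgauss UNIV = 1"
  using prob_space.emeasure_space_1[OF prob_space_cgauss] by simp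

lemma nn_integral_cgauss:
  assumes "f \<in> borel_measurable borel"
  shows "(\<integral>\<^sup>+ z. f z \<partial>cgauss) = (\<integral>\<^sup>+ z. ennreal (cgauss_density 1 z) * f z \<partial>lborel)"
  using assms by (simp add: cgauss_eq nn_integral_density)

lemma nn_integral_cgauss_uminus:
  assumes [measurable]: "f \<in> borel_measurable borel"
  shows "(\<integral>\<^sup>+ z. f (- z) \<partial>cgauss) = (\<integral>\<^sup>+ z. f z \<partial>cgauss)"
proof -
  have *: "distr lborel borel uminus = (lborel :: complex measure)"
    by (subst lborel_affine[of "-1" "0::complex"]) (auto simp: density_1)
  have "(\<integral>\<^sup>+ z. ennreal (cgauss_density 1 z) * f z \<partial>lborel) =
        (\<integral>\<^sup>+ z. ennreal (cgauss_density 1 z) * f z \<partial>distr lborel borel uminus)"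
    by (simp add: *)
  also have "\<dots> = (\<integral>\<^sup>+ z. ennreal (cgauss_density 1 (- z)) * f (- z) \<partial>lborel)"
    by (subst nn_integral_distr) auto
  finally show ?thesis
    by (simp add: nn_integral_cgauss cgauss_density_def)
qed

lemma nn_integral_cgauss_norm_square: "(\<integral>\<^sup>+ z. ennreal ((cmod z)\<^sup>2) \<partial>cgauss) = 1"
proof -
  define n where "n = normal_density 0 (sqrt (1 / 2))"
  have [measurable]: "n \<in> borel_measurable borel"
    by (simp add: n_def)
  have n0: "n x \<ge> 0" for x
    by (simp add: n_def)
  have "(\<integral>\<^sup>+ z. ennreal ((cmod z)\<^sup>2) \<partial>cgauss) =
     (\<integral>\<^sup>+ z. ennreal (n (Re z) * (Re z)\<^sup>2) * ennreal (n (Im z))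
        + ennreal (n (Re z)) * ennreal (n (Im z) * (Im z)\<^sup>2) \<partial>lborel)"
    by (simp add: nn_integral_cgauss cgauss_density_normal cmod_power2 n0
        flip: ennreal_mult ennreal_plus n_def) (simp add: algebra_simps)
  also have "\<dots> = ennreal (1 / 2) + ennreal (1 / 2)"
    using nn_integral_complex_prod[of "\<lambda>x. ennreal (n x * x\<^sup>2)" "\<lambda>x. ennreal (n x)"]
      nn_integral_complex_prod[of "\<lambda>x. ennreal (n x)" "\<lambda>x. ennreal (n x * x\<^sup>2)"]
      nn_integral_normal[of "sqrt (1/2)"]
    by (subst nn_integral_add) (auto simp: n_def[symmetric])
  also have "\<dots> = 1"
    by (subst ennreal_plus[symmetric]) auto
  finally show ?thesis .
qed

text \<open>By the symmetry \<open>z \<mapsto> -z\<close> the cross term vanishes without any integrability argument.\<close>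

lemma nn_integral_cgauss_affine:
  "(\<integral>\<^sup>+ z. ennreal ((cmod (a + c * z))\<^sup>2) \<partial>cgauss) = ennreal ((cmod a)\<^sup>2 + (cmod c)\<^sup>2)"
proof -
  interpret prob_space cgauss by (rule prob_space_cgauss)
  let ?I = "\<integral>\<^sup>+ z. ennreal ((cmod (a + c * z))\<^sup>2) \<partial>cgauss"
  have "(cmod (a + w))\<^sup>2 + (cmod (a - w))\<^sup>2 = 2 * ((cmod a)\<^sup>2 + (cmod w)\<^sup>2)" for w
    unfolding cmod_power2 by (simp add: power2_eq_square algebra_simps)
  from this[of "c * _"]
  have "?I + (\<integral>\<^sup>+ z. ennreal ((cmod (a + c * (- z)))\<^sup>2) \<partial>cgauss)
      = (\<integral>\<^sup>+ z. ennreal (2 * (cmod a)\<^sup>2) + ennreal (2 * (cmod c)\<^sup>2) * ennreal ((cmod z)\<^sup>2) \<partial>cgauss)"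
    by (subst nn_integral_add[symmetric])
       (auto simp: norm_mult power_mult_distrib algebra_simps simp flip: ennreal_plus ennreal_mult intro!: nn_integral_cong)
  also have "\<dots> = ennreal (2 * (cmod a)\<^sup>2 + 2 * (cmod c)\<^sup>2)"
    by (subst nn_integral_add)
       (auto simp: nn_integral_cmult nn_integral_cgauss_norm_square emeasure_cgauss)
  also have "\<dots> = 2 * ennreal ((cmod a)\<^sup>2 + (cmod c)\<^sup>2)"
    using ennreal_mult[of 2 "(cmod a)\<^sup>2 + (cmod c)\<^sup>2"] by (simp add: distrib_left)
  also have "(\<integral>\<^sup>+ z. ennreal ((cmod (a + c * (- z)))\<^sup>2) \<partial>cgauss) = ?I"
    by (rule nn_integral_cgauss_uminus) auto
  finally have "2 * ?I = 2 * ennreal ((cmod a)\<^sup>2 + (cmod c)\<^sup>2)"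
    by (simp add: mult_2)
  then show ?thesis
    unfolding ennreal_mult_cancel_left by simp
qed

section \<open>Pairs of independent noises\<close>

definition cgauss2 :: "(complex \<times> complex) measure" where
  "cgauss2 = cgauss \<Otimes>\<^sub>M cgauss"

lemma sets_cgauss2 [measurable_cong, simp]: "sets cgauss2 = sets borel"
  unfolding cgauss2_def by (simp add: borel_prod[symmetric] cong: sets_pair_measure_cong)

lemma space_cgauss2 [simp]: "space cgauss2 = UNIV"
  by (simp add: cgauss2_def space_pair_measure)

lemma prob_space_cgauss2: "prob_space cgauss2"
proof -
  interpret prob_space cgauss by (rule prob_space_cgauss)
  interpret pair_prob_space cgauss cgauss ..
  show ?thesis
    unfolding cgauss2_def by (rule P.prob_space_axioms)
qed

lemma nn_integral_cgauss2_affine: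
  "(\<integral>\<^sup>+ z. ennreal ((cmod (a + c * fst z + d * snd z))\<^sup>2) \<partial>cgauss2) =
     ennreal ((cmod a)\<^sup>2 + (cmod c)\<^sup>2 + (cmod d)\<^sup>2)"
proof -
  interpret prob_space cgauss by (rule prob_space_cgauss)
  have "(\<integral>\<^sup>+ z. ennreal ((cmod (a + c * fst z + d * snd z))\<^sup>2) \<partial>cgauss2) =
    (\<integral>\<^sup>+ z1. \<integral>\<^sup>+ z2. ennreal ((cmod ((a + c * z1) + d * z2))\<^sup>2) \<partial>cgauss \<partial>cgauss)"
    unfolding cgauss2_def by (subst nn_integral_fst[symmetric]) (auto)
  also have "\<dots> = (\<integral>\<^sup>+ z1. ennreal ((cmod (a + c * z1))\<^sup>2) + ennreal ((cmod d)\<^sup>2) \<partial>cgauss)"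
    by (simp add: nn_integral_cgauss_affine ennreal_plus)
  also have "\<dots> = ennreal ((cmod a)\<^sup>2 + (cmod c)\<^sup>2 + (cmod d)\<^sup>2)"
    by (subst nn_integral_add)
       (auto simp: nn_integral_cgauss_affine emeasure_cgauss simp flip: ennreal_plus)
  finally show ?thesis .
qed

lemma nn_integral_cgauss2:
  assumes "f \<in> borel_measurable borel"
  shows "(\<integral>\<^sup>+ z. f z \<partial>cgauss2) =
    (\<integral>\<^sup>+ z. ennreal (cgauss_density 1 (fst z) * cgauss_density 1 (snd z)) * f z \<partial>lborel)"
proof -
  have "cgauss2 = density (lborel \<Otimes>\<^sub>M lborel)
      (\<lambda>(x, y). ennreal (cgauss_density 1 x) * ennreal (cgauss_density 1 y))"
    unfolding cgauss2_def cgauss_eq using prob_space_cgauss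
    by (intro pair_measure_density)
       (auto intro: lborel.sigma_finite_measure_axioms prob_space_imp_sigma_finite simp: cgauss_eq)
  then have *: "cgauss2 = density lborel
      (\<lambda>z. ennreal (cgauss_density 1 (fst z) * cgauss_density 1 (snd z)))"
    by (simp add: lborel_prod split_beta' ennreal_mult cgauss_density_pos less_imp_le)
  show ?thesis
    using assms by (subst *, subst nn_integral_density) auto
qed

text \<open>The second coordinate is put outside because the reference laws draw \<open>y2\<close>
  first and then \<open>y1\<close> given \<open>y2\<close>.\<close>

lemma nn_integral_lborel_Pair:
  fixes f :: "complex \<times> complex \<Rightarrow> ennreal"
  assumes "f \<in> borel_measurable borel"
  shows "(\<integral>\<^sup>+ z. f z \<partial>lborel) = (\<integral>\<^sup>+ v. \<integral>\<^sup>+ u. f (u, v) \<partial>lborel \<partial>lborel)"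
  using assms by (subst lborel_pair.nn_integral_snd) (auto simp: lborel_prod)

section \<open>Output trajectories and change of measure\<close>

text \<open>Histories of every length share one space over all indices, with \<open>(0, 0)\<close>
  at the times not yet reached, as in \<open>hist\<close>. This avoids a product space for each
  time.\<close>

abbreviation histM :: "(nat \<Rightarrow> complex \<times> complex) measure" where
  "histM \<equiv> PiM UNIV (\<lambda>_. borel)"

text \<open>Encoders and gains are folded into the conditional mean \<open>m i\<close> of step
  \<open>i\<close>; measurability and the change of measure need nothing else about the
  channel.\<close>

fun traj :: "(nat \<Rightarrow> (nat \<Rightarrow> complex \<times> complex) \<Rightarrow> complex \<times> complex) \<Rightarrow>
    (nat \<Rightarrow> complex \<times> complex) \<Rightarrow> nat \<Rightarrow> nat \<Rightarrow> complex \<times> complex" where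
  "traj m z 0 = (\<lambda>_. (0, 0))"
| "traj m z (Suc i) = (traj m z i)(i := m i (traj m z i) + z i)"

lemma traj_cong: "(\<And>j. j < i \<Longrightarrow> z j = z' j) \<Longrightarrow> traj m z i = traj m z' i"
  by (induction i) auto

lemma noiseM_eq: "noiseM N = PiM {..<N} (\<lambda>_. cgauss2)"
  by (simp add: noiseM_def cgauss2_def)

lemma prob_space_noiseM: "prob_space (noiseM N)"
  unfolding noiseM_eq by (intro prob_space_PiM prob_space_cgauss2)

lemma measurable_noise_component:
  "i < N \<Longrightarrow> (\<lambda>z. z i) \<in> noiseM N \<rightarrow>\<^sub>M borel"
  using measurable_component_singleton[of i "{..<N}" "\<lambda>_. cgauss2"]
  by (simp add: noiseM_eq cong: measurable_cong_sets)

lemma measurable_traj: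
  assumes "\<And>j. j < i \<Longrightarrow> m j \<in> histM \<rightarrow>\<^sub>M borel" and "i \<le> N"
  shows "(\<lambda>z. traj m z i) \<in> noiseM N \<rightarrow>\<^sub>M histM"
  using assms
proof (induction i)
  case 0
  then show ?case by (auto simp: space_PiM)
next
  case (Suc i)
  have [measurable]: "(\<lambda>z. traj m z i) \<in> noiseM N \<rightarrow>\<^sub>M histM" "m i \<in> histM \<rightarrow>\<^sub>M borel"
     "(\<lambda>z. z i) \<in> noiseM N \<rightarrow>\<^sub>M borel"
    using Suc by (auto intro: measurable_noise_component)
  have "(\<lambda>z. (traj m z i)(i := m i (traj m z i) + z i)) \<in> noiseM N \<rightarrow>\<^sub>M histM"
    by (rule measurable_fun_upd[where J=UNIV]) auto
  then show ?case by (simp only: traj.simps)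
qed

text \<open>Integrating the noise of one time first is the form in which its independence from the
  past is used: a trajectory up to \<open>i\<close> does not read coordinate
  \<open>i\<close>.\<close>

lemma nn_integral_noiseM_insert:
  assumes "i < N" and "f \<in> borel_measurable (noiseM N)"
  shows "(\<integral>\<^sup>+ z. f z \<partial>noiseM N) =
    (\<integral>\<^sup>+ z. \<integral>\<^sup>+ y. f (z(i := y)) \<partial>cgauss2 \<partial>PiM ({..<N} - {i}) (\<lambda>_. cgauss2))"
proof -
  interpret product_sigma_finite "\<lambda>_::nat. cgauss2"
    by (intro product_sigma_finite.intro prob_space_imp_sigma_finite prob_space_cgauss2)
  have "insert i ({..<N} - {i}) = {..<N}"
    using assms by auto
  then show ?thesis
    using product_nn_integral_insert[of "{..<N} - {i}" i f] assms by (simp add: noiseM_eq)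
qed

text \<open>\<open>refint q n F\<close> is the iterated Lebesgue integral of \<open>F\<close> against the sequential density
  \<open>q 0 h y\<^sub>0 * q 1 h y\<^sub>1 * \<dots>\<close>, where step \<open>j\<close> only sees the coordinates of \<open>h\<close> below \<open>j\<close>.\<close>

fun refint :: "(nat \<Rightarrow> (nat \<Rightarrow> complex \<times> complex) \<Rightarrow> complex \<times> complex \<Rightarrow> ennreal) \<Rightarrow> nat \<Rightarrow>
    ((nat \<Rightarrow> complex \<times> complex) \<Rightarrow> ennreal) \<Rightarrow> ennreal" where
  "refint q 0 F = F (\<lambda>_. (0, 0))"
| "refint q (Suc n) F = refint q n (\<lambda>h. \<integral>\<^sup>+ y. q n h y * F (h(n := y)) \<partial>lborel)"

lemma measurable_hist_section:
  assumes "(\<lambda>x. f (fst x) (snd x)) \<in> histM \<Otimes>\<^sub>M borel \<rightarrow>\<^sub>M M"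
  shows "f h \<in> borel \<rightarrow>\<^sub>M M"
proof -
  have "(\<lambda>y. (h, y)) \<in> borel \<rightarrow>\<^sub>M histM \<Otimes>\<^sub>M borel"
    by (auto simp: space_PiM)
  from measurable_compose[OF this assms] show ?thesis by simp
qed

lemma measurable_hist_upd:
  "(\<lambda>x. (fst x)(n := snd x)) \<in> histM \<Otimes>\<^sub>M borel \<rightarrow>\<^sub>M histM"
  by (rule measurable_fun_upd[where J=UNIV]) auto

lemma measurable_refint_step:
  assumes [measurable]: "(\<lambda>x. q (fst x) (snd x)) \<in> borel_measurable (histM \<Otimes>\<^sub>M borel)"
    "F \<in> borel_measurable histM"
  shows "(\<lambda>h. \<integral>\<^sup>+ y. q h y * F (h(n := y)) \<partial>lborel) \<in> borel_measurable histM"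
proof (rule lborel.borel_measurable_nn_integral)
  note [measurable] = measurable_hist_upd[of n]
  have "(\<lambda>x. q (fst x) (snd x) * F ((fst x)(n := snd x))) \<in> borel_measurable (histM \<Otimes>\<^sub>M borel)"
    by measurable
  then show "(\<lambda>(h, y). q h y * F (h(n := y))) \<in> borel_measurable (histM \<Otimes>\<^sub>M lborel)"
    by (simp add: split_beta' cong: measurable_cong_sets sets_pair_measure_cong)
qed

lemma refint_mono: "(\<And>h. F h \<le> G h) \<Longrightarrow> refint q n F \<le> refint q n G"
proof (induction n arbitrary: F G)
  case (Suc n)
  show ?case
    unfolding refint.simps by (intro Suc.IH nn_integral_mono mult_left_mono Suc.prems) simp
qed simp

lemma refint_sum:
  assumes "\<And>j. j < n \<Longrightarrow> (\<lambda>x. q j (fst x) (snd x)) \<in> borel_measurable (histM \<Otimes>\<^sub>M borel)"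
    and "\<And>k. k \<in> A \<Longrightarrow> F k \<in> borel_measurable histM"
  shows "refint q n (\<lambda>h. \<Sum>k\<in>A. F k h) = (\<Sum>k\<in>A. refint q n (F k))"
  using assms
proof (induction n arbitrary: F)
  case (Suc n)
  have [measurable]: "(\<lambda>x. q n (fst x) (snd x)) \<in> borel_measurable (histM \<Otimes>\<^sub>M borel)"
    by (rule Suc.prems) simp
  have *: "(\<lambda>y. q n h y * F k (h(n := y))) \<in> borel_measurable lborel" if "k \<in> A" for h k
  proof -
    have [measurable]: "q n h \<in> borel_measurable borel"
      by (rule measurable_hist_section) (rule Suc.prems(1), simp)
    have "(\<lambda>y. F k (h(n := y))) \<in> borel_measurable borel"
      using measurable_hist_section[OF measurable_hist_upd] Suc.prems(2)[OF that]
      by (rule measurable_compose)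
    then have "(\<lambda>y. q n h y * F k (h(n := y))) \<in> borel_measurable borel"
      by (intro borel_measurable_times_ennreal) auto
    then show ?thesis by simp
  qed
  have "refint q (Suc n) (\<lambda>h. \<Sum>k\<in>A. F k h) =
    refint q n (\<lambda>h. \<Sum>k\<in>A. \<integral>\<^sup>+ y. q n h y * F k (h(n := y)) \<partial>lborel)"
    using * by (simp add: sum_distrib_left nn_integral_sum)
  also have "\<dots> = (\<Sum>k\<in>A. refint q (Suc n) (F k))"
    using Suc by (subst Suc.IH) (auto intro!: measurable_refint_step)
  finally show ?case .
qed simp

lemma refint_one:
  assumes "\<And>j h. j < n \<Longrightarrow> (\<integral>\<^sup>+ y. q j h y \<partial>lborel) = 1"
  shows "refint q n (\<lambda>_. 1) = 1"
  using assms by (induction n) auto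

text \<open>If at each step the second coordinate is drawn independently of the past, then its block has the
  same law whatever the first coordinate does.\<close>

lemma refint_marginal_snd:
  assumes q: "\<And>j. j < n \<Longrightarrow> (\<lambda>x. q j (fst x) (snd x)) \<in> borel_measurable (histM \<Otimes>\<^sub>M borel)"
    and q': "\<And>j. j < n \<Longrightarrow> (\<lambda>x. q' j (fst x) (snd x)) \<in> borel_measurable (histM \<Otimes>\<^sub>M borel)"
    and r: "\<And>j. j < n \<Longrightarrow> r j \<in> borel_measurable borel"
    and "\<And>j h v. j < n \<Longrightarrow> (\<integral>\<^sup>+ u. q j h (u, v) \<partial>lborel) = r j v"
    and "\<And>j h v. j < n \<Longrightarrow> (\<integral>\<^sup>+ u. q' j h (u, v) \<partial>lborel) = r j v"
    and "F \<in> borel_measurable (PiM UNIV (\<lambda>_. borel))"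
  shows "refint q n (\<lambda>h. F (snd \<circ> h)) = refint q' n (\<lambda>h. F (snd \<circ> h))"
  using assms
proof (induction n arbitrary: F)
  case (Suc n)
  \<comment> \<open>Integrating out the last second coordinate against its common law
    \<open>r n\<close> leaves a function of the earlier second coordinates alone, which takes the
    place of \<open>F\<close> in the induction hypothesis.\<close>
  define G where "G g = (\<integral>\<^sup>+ v. r n v * F (g(n := v)) \<partial>lborel)" for g :: "nat \<Rightarrow> complex"
  have upd: "snd \<circ> h(n := y) = (snd \<circ> h)(n := snd y)" for h :: "nat \<Rightarrow> complex \<times> complex" and y
    by auto
  have mupd [measurable]: "(\<lambda>x. (fst x)(n := snd x)) \<in> PiM UNIV (\<lambda>_. borel) \<Otimes>\<^sub>M borel \<rightarrow>\<^sub>M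
      (PiM UNIV (\<lambda>_. borel) :: (nat \<Rightarrow> complex) measure)"
    by (rule measurable_fun_upd[where J=UNIV]) auto
  have [measurable]: "r n \<in> borel_measurable borel" "F \<in> borel_measurable (PiM UNIV (\<lambda>_. borel))"
    using Suc.prems by auto
  have G [measurable]: "G \<in> borel_measurable (PiM UNIV (\<lambda>_. borel))"
    unfolding G_def
  proof (rule lborel.borel_measurable_nn_integral)
    have "(\<lambda>x. r n (snd x) * F ((fst x)(n := snd x)))
        \<in> borel_measurable (PiM UNIV (\<lambda>_. borel) \<Otimes>\<^sub>M borel)"
      by measurable
    then show "(\<lambda>(g, v). r n v * F (g(n := v))) \<in> borel_measurable (PiM UNIV (\<lambda>_. borel) \<Otimes>\<^sub>M lborel)"
      by (simp add: split_beta' cong: measurable_cong_sets sets_pair_measure_cong)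
  qed
  have step: "(\<integral>\<^sup>+ y. p n h y * F (snd \<circ> h(n := y)) \<partial>lborel) = G (snd \<circ> h)"
    if p: "(\<lambda>x. p n (fst x) (snd x)) \<in> borel_measurable (histM \<Otimes>\<^sub>M borel)"
      and pr: "\<And>h v. (\<integral>\<^sup>+ u. p n h (u, v) \<partial>lborel) = r n v"
    for p :: "nat \<Rightarrow> (nat \<Rightarrow> complex \<times> complex) \<Rightarrow> complex \<times> complex \<Rightarrow> ennreal" and h
  proof -
    have [measurable]: "p n h \<in> borel_measurable borel"
      by (rule measurable_hist_section[OF p])
    have [measurable]: "(\<lambda>v. (snd \<circ> h)(n := v)) \<in> borel \<rightarrow>\<^sub>M PiM UNIV (\<lambda>_. borel)"
      by (rule measurable_fun_upd[where J=UNIV]) (auto simp: space_PiM)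
    have "(\<integral>\<^sup>+ y. p n h y * F (snd \<circ> h(n := y)) \<partial>lborel) =
       (\<integral>\<^sup>+ v. \<integral>\<^sup>+ u. p n h (u, v) * F ((snd \<circ> h)(n := v)) \<partial>lborel \<partial>lborel)"
      unfolding upd by (subst nn_integral_lborel_Pair) auto
    also have "\<dots> = (\<integral>\<^sup>+ v. r n v * F ((snd \<circ> h)(n := v)) \<partial>lborel)"
      by (simp add: nn_integral_multc pr)
    finally show ?thesis by (simp add: G_def)
  qed
  have "refint q n (\<lambda>h. G (snd \<circ> h)) = refint q' n (\<lambda>h. G (snd \<circ> h))"
    using Suc.prems by (intro Suc.IH G) auto
  then show ?case
    unfolding refint.simps using Suc.prems by (simp only: step lessI)
qed simp

text \<open>Given the past, an output is the noise translated by \<open>m j h\<close>. The factor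
  \<open>r j h z\<close> is the density of step \<open>j\<close> of \<open>q\<close> at that output
  relative to the noise density at \<open>z\<close>, so translation invariance of Lebesgue measure
  turns the weighted integral over the last noise into a \<open>q\<close>-integral, and the steps
  are peeled off from the end.\<close>

lemma change_of_measure:
  assumes m: "\<And>j. j < N \<Longrightarrow> m j \<in> histM \<rightarrow>\<^sub>M borel"
    and r: "\<And>j. j < N \<Longrightarrow> (\<lambda>x. r j (fst x) (snd x)) \<in> borel_measurable (histM \<Otimes>\<^sub>M borel)"
    and q: "\<And>j. j < N \<Longrightarrow> (\<lambda>x. q j (fst x) (snd x)) \<in> borel_measurable (histM \<Otimes>\<^sub>M borel)"
    and rq: "\<And>j h z. j < N \<Longrightarrow>
       ennreal (cgauss_density 1 (fst z) * cgauss_density 1 (snd z)) * r j h z = q j h (m j h + z)"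
    and F: "F \<in> borel_measurable histM"
  shows "(\<integral>\<^sup>+ z. (\<Prod>j<N. r j (traj m z j) (z j)) * F (traj m z N) \<partial>noiseM N) = refint q N F"
  using assms
proof (induction N arbitrary: F)
  case 0
  interpret prob_space "noiseM 0" by (rule prob_space_noiseM)
  show ?case by (simp add: emeasure_space_1)
next
  case (Suc N)
  have [measurable]: "m N \<in> histM \<rightarrow>\<^sub>M borel" "F \<in> borel_measurable histM"
    and r' [measurable]: "(\<lambda>x. r N (fst x) (snd x)) \<in> borel_measurable (histM \<Otimes>\<^sub>M borel)"
    and q' [measurable]: "(\<lambda>x. q N (fst x) (snd x)) \<in> borel_measurable (histM \<Otimes>\<^sub>M borel)"
    using Suc.prems by auto
  define L where "L z = (\<Prod>j<N. r j (traj m z j) (z j))" for z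
  define G where "G h = (\<integral>\<^sup>+ y. q N h y * F (h(N := y)) \<partial>lborel)" for h
  have mt: "(\<lambda>z. traj m z j) \<in> noiseM N' \<rightarrow>\<^sub>M histM" if "j \<le> Suc N" "j \<le> N'" for j N'
    using that Suc.prems by (intro measurable_traj) auto
  have mr: "(\<lambda>z. r j (traj m z j) (z j)) \<in> borel_measurable (noiseM N')" if "j < Suc N" "j < N'" for j N'
  proof -
    have "(\<lambda>z. (traj m z j, z j)) \<in> noiseM N' \<rightarrow>\<^sub>M histM \<Otimes>\<^sub>M borel"
      using that by (intro measurable_Pair mt measurable_noise_component) auto
    from measurable_compose[OF this Suc.prems(2)[OF that(1)]] show ?thesis by simp
  qed
  have [measurable]: "L \<in> borel_measurable (noiseM N)"
    unfolding L_def by (intro borel_measurable_prod_ennreal mr) auto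
  have inner: "(\<integral>\<^sup>+ y. r N h y * F (h(N := m N h + y)) \<partial>cgauss2) = G h"
    and inner_meas: "(\<lambda>y. r N h y * F (h(N := m N h + y))) \<in> borel_measurable borel" for h
  proof -
    note [measurable] = measurable_hist_section[OF r', of h] measurable_hist_section[OF q', of h]
      measurable_hist_section[OF measurable_hist_upd, of h N]
    show "(\<lambda>y. r N h y * F (h(N := m N h + y))) \<in> borel_measurable borel"
      by measurable
    then have "(\<integral>\<^sup>+ y. r N h y * F (h(N := m N h + y)) \<partial>cgauss2) =
       (\<integral>\<^sup>+ y. q N h (m N h + y) * F (h(N := m N h + y)) \<partial>lborel)"
      using Suc.prems(4)[of N] by (subst nn_integral_cgauss2) (auto simp flip: mult.assoc)
    also have "\<dots> = G h"
      unfolding G_def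
      by (rule nn_integral_lborel_translate[of "\<lambda>y. q N h y * F (h(N := y))" "m N h"]) measurable
    finally show "(\<integral>\<^sup>+ y. r N h y * F (h(N := m N h + y)) \<partial>cgauss2) = G h" .
  qed
  \<comment> \<open>Causality: earlier outputs, and with them the factors collected in
    \<open>L\<close>, do not change with the last noise, so \<open>L\<close> leaves the inner
    integral.\<close>
  have upd: "traj m (z(N := y)) j = traj m z j" if "j \<le> N" for z y j
    using that by (intro traj_cong) auto
  have meas: "(\<lambda>z. (\<Prod>j<Suc N. r j (traj m z j) (z j)) * F (traj m z (Suc N)))
      \<in> borel_measurable (noiseM (Suc N))"
    by (intro borel_measurable_times_ennreal borel_measurable_prod_ennreal mr
        measurable_compose[OF mt \<open>F \<in> _\<close>]) auto
  have "(\<integral>\<^sup>+ z. (\<Prod>j<Suc N. r j (traj m z j) (z j)) * F (traj m z (Suc N)) \<partial>noiseM (Suc N)) =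
    (\<integral>\<^sup>+ z. \<integral>\<^sup>+ y. L z * (r N (traj m z N) y
        * F ((traj m z N)(N := m N (traj m z N) + y))) \<partial>cgauss2 \<partial>noiseM N)"
  proof (subst nn_integral_noiseM_insert[OF _ meas, of N])
    have "{..<Suc N} - {N} = {..<N}" by auto
    moreover have "(\<Prod>j<N. r j (traj m (z(N := y)) j) ((z(N := y)) j)) = L z" for z y
      unfolding L_def by (intro prod.cong) (auto simp: upd)
    ultimately show "(\<integral>\<^sup>+ z. \<integral>\<^sup>+ y. (\<Prod>j<Suc N. r j (traj m (z(N := y)) j) ((z(N := y)) j))
        * F (traj m (z(N := y)) (Suc N)) \<partial>cgauss2 \<partial>PiM ({..<Suc N} - {N}) (\<lambda>_. cgauss2)) =
     (\<integral>\<^sup>+ z. \<integral>\<^sup>+ y. L z * (r N (traj m z N) y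
        * F ((traj m z N)(N := m N (traj m z N) + y))) \<partial>cgauss2 \<partial>noiseM N)"
      by (simp add: noiseM_eq upd mult.assoc)
  qed simp
  also have "\<dots> = (\<integral>\<^sup>+ z. L z * G (traj m z N) \<partial>noiseM N)"
    using inner_meas by (simp add: nn_integral_cmult inner cong: measurable_cong_sets)
  also have "\<dots> = refint q N G"
    unfolding L_def using Suc.prems
    by (intro Suc.IH) (auto simp: G_def[abs_def] intro!: measurable_refint_step)
  finally show ?case
    by (simp only: G_def[abs_def] refint.simps)
qed

section \<open>The likelihood-ratio converse\<close>

text \<open>This plays the role of Fano's inequality. Here \<open>exp (- l w)\<close> is the density
  of the reference law relative to the true one, and \<open>K\<close> bounds the total reference
  mass of the decoding events. The inequality \<open>1 + t <= exp t\<close> is applied to a mixture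
  of the weights \<open>1\<close> and \<open>a * indicator (C w)\<close>. The first weight controls
  the outcomes outside \<open>C w\<close>, where only the total mass is known; halving both costs
  \<open>ln 2\<close> for each \<open>w\<close>.\<close>

lemma likelihood_ratio_converse:
  fixes l :: "'w \<Rightarrow> 'a \<Rightarrow> real" and C :: "'w \<Rightarrow> 'a set"
  assumes "prob_space M" "finite W" "K > 0"
    and l: "\<And>w. w \<in> W \<Longrightarrow> integrable M (l w)"
    and C: "\<And>w. w \<in> W \<Longrightarrow> C w \<in> sets M"
    and le1: "\<And>w. w \<in> W \<Longrightarrow> (\<integral>\<^sup>+ x. ennreal (exp (- l w x)) \<partial>M) \<le> 1"
    and leK: "(\<Sum>w\<in>W. \<integral>\<^sup>+ x. ennreal (exp (- l w x)) * indicator (C w) x \<partial>M) \<le> ennreal K"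
  shows "(\<Sum>w\<in>W. measure M (C w)) * ln (card W / K) \<le> (\<Sum>w\<in>W. \<integral>x. l w x \<partial>M) + card W * ln 2"
proof (cases "W = {}")
  case False
  interpret prob_space M by fact
  \<comment> \<open>The weight that balances the mixture: since \<open>a * K = card W\<close>, both
    parts contribute at most \<open>card W\<close> to the sum.\<close>
  define a where "a = card W / K"
  define A where "A w = (\<integral>x. exp (- l w x) \<partial>M)" for w
  define B where "B w = (\<integral>x. exp (- l w x) * indicator (C w) x \<partial>M)" for w
  have a: "a > 0"
    using assms False by (simp add: a_def card_gt_0_iff)
  have int: "integrable M (\<lambda>x. exp (- l w x))" if "w \<in> W" for w
    using l[OF that] le1[OF that]
    by (intro integrableI_nonneg) (auto intro: order_le_less_trans)
  have intB: "integrable M (\<lambda>x. exp (- l w x) * indicator (C w) x)" if "w \<in> W" for w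
    using int C that by (intro integrable_real_mult_indicator) auto
  have A1: "A w \<le> 1" if "w \<in> W" for w
    using le1[OF that] int[OF that] by (simp add: A_def nn_integral_eq_integral)
  have B_eq: "ennreal (\<Sum>w\<in>W. B w) = (\<Sum>w\<in>W. \<integral>\<^sup>+ x. ennreal (exp (- l w x)) * indicator (C w) x \<partial>M)"
  proof (subst sum_ennreal[symmetric])
    show "(\<Sum>w\<in>W. ennreal (B w)) = (\<Sum>w\<in>W. \<integral>\<^sup>+ x. ennreal (exp (- l w x)) * indicator (C w) x \<partial>M)"
      unfolding B_def using intB
      by (intro sum.cong refl, subst nn_integral_eq_integral[symmetric])
         (auto intro!: nn_integral_cong simp: indicator_def)
  qed (auto simp: B_def intro!: integral_nonneg_AE)
  have BK: "(\<Sum>w\<in>W. B w) \<le> K"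
    using leK \<open>K > 0\<close> unfolding B_eq[symmetric] by simp
  have "ln a * measure M (C w) - (\<integral>x. l w x \<partial>M) - ln 2 \<le> (A w + a * B w) / 2 - 1" if "w \<in> W" for w
  proof -
    have "ln a * indicator (C w) x - l w x - ln 2 \<le>
        (exp (- l w x) + a * (exp (- l w x) * indicator (C w) x)) / 2 - 1" for x
    proof -
      define t where "t = ln a * indicator (C w) x - l w x - ln 2"
      have "1 + t \<le> exp t"
        by (rule exp_ge_add_one_self)
      \<comment> \<open>On \<open>C w\<close> the first summand is dropped; off \<open>C w\<close>
        the second one vanishes.\<close>
      also have "exp t \<le> (exp (- l w x) + a * (exp (- l w x) * indicator (C w) x)) / 2"
        unfolding t_def diff_conv_add_uminus exp_add exp_minus[of "ln 2"]
        using a by (auto simp: indicator_def)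
      finally show ?thesis unfolding t_def by linarith
    qed
    moreover have ind: "integrable M (indicator (C w) :: 'a \<Rightarrow> real)"
      using C[OF that] by (intro integrable_real_indicator) (auto simp: less_top[symmetric])
    ultimately have "(\<integral>x. ln a * indicator (C w) x - l w x - ln 2 \<partial>M) \<le>
        (\<integral>x. (exp (- l w x) + a * (exp (- l w x) * indicator (C w) x)) / 2 - 1 \<partial>M)"
      using ind l[OF that] int[OF that] intB[OF that]
      by (intro integral_mono Bochner_Integration.integrable_diff Bochner_Integration.integrable_add
          integrable_divide integrable_mult_right integrable_const)
    moreover have "(\<integral>x. ln a * indicator (C w) x - l w x - ln 2 \<partial>M) =
        ln a * measure M (C w) - (\<integral>x. l w x \<partial>M) - ln 2"
      using ind l[OF that] C[OF that] sets.sets_into_space[OF C[OF that]] by (simp add: prob_space Int_absorb1)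
    moreover have "(\<integral>x. (exp (- l w x) + a * (exp (- l w x) * indicator (C w) x)) / 2 - 1 \<partial>M) =
        (A w + a * B w) / 2 - 1"
      unfolding A_def B_def using int[OF that] intB[OF that] by (simp add: prob_space)
    ultimately show ?thesis by simp
  qed
  then have "(\<Sum>w\<in>W. ln a * measure M (C w) - (\<integral>x. l w x \<partial>M) - ln 2) \<le>
      (\<Sum>w\<in>W. (A w + a * B w) / 2 - 1)"
    by (rule sum_mono)
  also have "\<dots> = ((\<Sum>w\<in>W. A w) + a * (\<Sum>w\<in>W. B w)) / 2 - card W"
    by (simp add: sum_subtractf sum.distrib sum_divide_distrib[symmetric] sum_distrib_left)
  also have "\<dots> \<le> (card W + a * K) / 2 - card W"
    using sum_bounded_above[of W A 1] A1 BK a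
    by (intro diff_right_mono divide_right_mono add_mono mult_left_mono) auto
  also have "\<dots> = 0"
    using \<open>K > 0\<close> by (simp add: a_def)
  finally have "(\<Sum>w\<in>W. ln a * measure M (C w) - (\<integral>x. l w x \<partial>M) - ln 2) \<le> 0" .
  moreover have "(\<Sum>w\<in>W. ln a * measure M (C w) - (\<integral>x. l w x \<partial>M) - ln 2) =
      (\<Sum>w\<in>W. measure M (C w)) * ln a - (\<Sum>w\<in>W. \<integral>x. l w x \<partial>M) - card W * ln 2"
    by (simp only: sum_subtractf sum_distrib_left[symmetric] sum_constant of_nat_mult mult.commute)
  ultimately show ?thesis
    unfolding a_def by linarith
qed simp

text \<open>The history before \<open>i\<close> is independent of the noise at \<open>i\<close>,
  which is centred; so the mean square of the history term and those of the two noise terms add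
  up.\<close>

lemma nn_integral_noise_affine:
  assumes "i < N" and m: "\<And>j. j < i \<Longrightarrow> m j \<in> histM \<rightarrow>\<^sub>M borel"
    and A [measurable]: "A \<in> borel_measurable histM"
  shows "(\<integral>\<^sup>+ z. ennreal ((cmod (A (traj m z i) + c * fst (z i) + d * snd (z i)))\<^sup>2) \<partial>noiseM N) =
    (\<integral>\<^sup>+ z. ennreal ((cmod (A (traj m z i)))\<^sup>2) \<partial>noiseM N) + ennreal ((cmod c)\<^sup>2 + (cmod d)\<^sup>2)"
proof -
  have [measurable]: "(\<lambda>z. traj m z i) \<in> noiseM N \<rightarrow>\<^sub>M histM" "(\<lambda>z. z i) \<in> noiseM N \<rightarrow>\<^sub>M borel"
    using assms by (auto intro: measurable_traj measurable_noise_component)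
  interpret prob_space "PiM ({..<N} - {i}) (\<lambda>_. cgauss2)"
    by (intro prob_space_PiM prob_space_cgauss2)
  have one: "emeasure cgauss2 UNIV = 1"
    using prob_space.emeasure_space_1[OF prob_space_cgauss2] by simp
  have upd: "traj m (z(i := y)) i = traj m z i" for z y
    by (intro traj_cong) auto
  \<comment> \<open>Measurability in the remaining noises: filling coordinate \<open>i\<close> with
    zeros lands in the full noise space and leaves the trajectory up to \<open>i\<close>
    unchanged.\<close>
  have "(\<lambda>z. (cmod (A (traj m (z(i := (0, 0))) i)))\<^sup>2) \<in> borel_measurable (PiM ({..<N} - {i}) (\<lambda>_. cgauss2))"
  proof -
    have "(\<lambda>z. z(i := (0, 0))) \<in> PiM ({..<N} - {i}) (\<lambda>_. cgauss2) \<rightarrow>\<^sub>M noiseM N"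
      unfolding noiseM_eq using \<open>i < N\<close>
      by (intro measurable_fun_upd[where J="{..<N} - {i}"]) auto
    then show ?thesis by measurable
  qed
  then have "(\<lambda>z. (cmod (A (traj m z i)))\<^sup>2) \<in> borel_measurable (PiM ({..<N} - {i}) (\<lambda>_. cgauss2))"
    by (simp only: upd)
  then show ?thesis
    using nn_integral_cgauss2_affine[of "A (traj m _ i)" c d] \<open>i < N\<close>
    by (simp add: nn_integral_noiseM_insert[OF \<open>i < N\<close>] upd one add.assoc ennreal_plus
       nn_integral_add emeasure_space_1 del: ennreal_plus) (simp add: nn_integral_add emeasure_space_1)
qed

lemma has_integral_noise_affine:
  assumes "i < N" "\<And>j. j < i \<Longrightarrow> m j \<in> histM \<rightarrow>\<^sub>M borel" "A \<in> borel_measurable histM"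
    and "integrable (noiseM N) (\<lambda>z. (cmod (A (traj m z i)))\<^sup>2)"
  shows "has_bochner_integral (noiseM N)
    (\<lambda>z. (cmod (A (traj m z i) + c * fst (z i) + d * snd (z i)))\<^sup>2)
    ((\<integral>z. (cmod (A (traj m z i)))\<^sup>2 \<partial>noiseM N) + (cmod c)\<^sup>2 + (cmod d)\<^sup>2)"
proof (rule has_bochner_integral_nn_integral)
  note [measurable] = assms(3)
  have [measurable]: "(\<lambda>z. traj m z i) \<in> noiseM N \<rightarrow>\<^sub>M histM" "(\<lambda>z. z i) \<in> noiseM N \<rightarrow>\<^sub>M borel"
    using assms by (auto intro: measurable_traj measurable_noise_component)
  show "(\<lambda>z. (cmod (A (traj m z i) + c * fst (z i) + d * snd (z i)))\<^sup>2) \<in> borel_measurable (noiseM N)"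
    by measurable
  have "(\<integral>\<^sup>+ z. ennreal ((cmod (A (traj m z i)))\<^sup>2) \<partial>noiseM N)
      = ennreal (\<integral>z. (cmod (A (traj m z i)))\<^sup>2 \<partial>noiseM N)"
    using assms by (intro nn_integral_eq_integral) auto
  then show "(\<integral>\<^sup>+ z. ennreal ((cmod (A (traj m z i) + c * fst (z i) + d * snd (z i)))\<^sup>2) \<partial>noiseM N) =
    ennreal ((\<integral>z. (cmod (A (traj m z i)))\<^sup>2 \<partial>noiseM N) + (cmod c)\<^sup>2 + (cmod d)\<^sup>2)"
    using assms(1-3) by (subst nn_integral_noise_affine) (simp_all add: add.assoc)
qed auto

section \<open>Second moments of the channel inputs\<close>

lemma has_bochner_integral_cmod_lin:
  fixes x y :: "'a \<Rightarrow> complex"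
  assumes "integrable M (\<lambda>z. (cmod (x z))\<^sup>2)" "integrable M (\<lambda>z. (cmod (y z))\<^sup>2)"
    "integrable M (\<lambda>z. x z * cnj (y z))"
  shows "has_bochner_integral M (\<lambda>z. (cmod (p * x z + r * y z))\<^sup>2)
    ((cmod p)\<^sup>2 * (\<integral>z. (cmod (x z))\<^sup>2 \<partial>M) + (cmod r)\<^sup>2 * (\<integral>z. (cmod (y z))\<^sup>2 \<partial>M)
      + 2 * Re (p * cnj r * (\<integral>z. x z * cnj (y z) \<partial>M)))"
proof -
  have "(cmod (p * x z + r * y z))\<^sup>2 = (cmod p)\<^sup>2 * (cmod (x z))\<^sup>2 + (cmod r)\<^sup>2 * (cmod (y z))\<^sup>2
      + 2 * Re (p * cnj r * (x z * cnj (y z)))" for z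
    unfolding cmod_power2 by (simp add: power2_eq_square algebra_simps)
  then show ?thesis
    by (simp only:)
       (intro has_bochner_integral_add has_bochner_integral_mult_right has_bochner_integral_integrable
          has_bochner_integral_bounded_linear[OF bounded_linear_Re] assms)
qed

section \<open>Codes as causal functions of the output history\<close>

locale feedback_scheme =
  fixes g11 g12 g21 g22 :: complex and f1 f2 :: encoder and d1 d2 :: decoder and N :: nat
  assumes f1: "f1 i w \<in> borel_measurable (PiM {..<i} (\<lambda>_. borel))"
    and f2: "f2 i w \<in> borel_measurable (PiM {..<i} (\<lambda>_. borel))"
    and d1: "d1 \<in> measurable (PiM {..<N} (\<lambda>_. borel)) (count_space UNIV)"
    and d2: "d2 \<in> measurable (PiM {..<N} (\<lambda>_. borel)) (count_space UNIV)"
begin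

text \<open>Inputs, and below the events of correct decoding, are expressed through the output
  history rather than the noise, so that they make sense under a reference law as well.\<close>

definition X1 :: "nat \<Rightarrow> nat \<Rightarrow> (nat \<Rightarrow> complex \<times> complex) \<Rightarrow> complex" where
  "X1 i w h = f1 i w (restrict (fst \<circ> h) {..<i})"
definition X2 :: "nat \<Rightarrow> nat \<Rightarrow> (nat \<Rightarrow> complex \<times> complex) \<Rightarrow> complex" where
  "X2 i w h = f2 i w (restrict (snd \<circ> h) {..<i})"

definition "mean w1 w2 i h =
  (g11 * X1 i w1 h + g21 * X2 i w2 h, g12 * X1 i w1 h + g22 * X2 i w2 h)"

abbreviation "out w1 w2 \<equiv> traj (mean w1 w2)"

lemma hist_eq: "hist g11 g12 g21 g22 f1 f2 w1 w2 z i = out w1 w2 z i"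
  by (induction i) (simp_all add: Let_def mean_def X1_def X2_def plus_prod_def)

lemma tx_eq:
  "tx1 g11 g12 g21 g22 f1 f2 w1 w2 z i = X1 i w1 (out w1 w2 z i)"
  "tx2 g11 g12 g21 g22 f1 f2 w1 w2 z i = X2 i w2 (out w1 w2 z i)"
  by (simp_all add: tx1_def tx2_def hist_eq X1_def X2_def)

lemma measurable_restrict_comp:
  "p \<in> borel \<rightarrow>\<^sub>M borel \<Longrightarrow> (\<lambda>h. restrict (p \<circ> h) {..<i}) \<in> histM \<rightarrow>\<^sub>M PiM {..<i} (\<lambda>_. borel)"
  unfolding comp_def
  by (intro measurable_restrict measurable_compose[OF measurable_component_singleton]) auto

lemma measurable_X [measurable]:
  "X1 i w \<in> borel_measurable histM" "X2 i w \<in> borel_measurable histM"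
  unfolding X1_def[abs_def] X2_def[abs_def]
  by (rule measurable_compose[OF measurable_restrict_comp f1] measurable_compose[OF measurable_restrict_comp f2],
      measurable)+

lemma measurable_mean: "mean w1 w2 i \<in> histM \<rightarrow>\<^sub>M borel"
  unfolding mean_def[abs_def] by measurable

lemma measurable_out [measurable]: "i \<le> N \<Longrightarrow> (\<lambda>z. out w1 w2 z i) \<in> noiseM N \<rightarrow>\<^sub>M histM"
  by (intro measurable_traj measurable_mean)

definition "correct1 w = {h :: nat \<Rightarrow> complex \<times> complex. d1 (restrict (fst \<circ> h) {..<N}) = w}"
definition "correct2 w = {h :: nat \<Rightarrow> complex \<times> complex. d2 (restrict (snd \<circ> h) {..<N}) = w}"

lemma measurable_correct [measurable]: "correct1 w \<in> sets histM" "correct2 w \<in> sets histM"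
proof -
  have "(\<lambda>h. d1 (restrict (fst \<circ> h) {..<N})) \<in> histM \<rightarrow>\<^sub>M count_space UNIV"
    by (rule measurable_compose[OF measurable_restrict_comp d1]) measurable
  from measurable_sets[OF this, of "{w}"] show "correct1 w \<in> sets histM"
    by (simp add: correct1_def vimage_def space_PiM)
  have "(\<lambda>h. d2 (restrict (snd \<circ> h) {..<N})) \<in> histM \<rightarrow>\<^sub>M count_space UNIV"
    by (rule measurable_compose[OF measurable_restrict_comp d2]) measurable
  from measurable_sets[OF this, of "{w}"] show "correct2 w \<in> sets histM"
    by (simp add: correct2_def vimage_def space_PiM)
qed

definition "success w1 w2 = {z \<in> space (noiseM N). out w1 w2 z N \<in> correct1 w1 \<inter> correct2 w2}"

lemma sets_success: "success w1 w2 \<in> sets (noiseM N)"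
proof -
  have "(\<lambda>z. out w1 w2 z N) \<in> noiseM N \<rightarrow>\<^sub>M histM"
    by (rule measurable_out) simp
  from measurable_sets[OF this sets.Int[OF measurable_correct(1) measurable_correct(2)]]
  show ?thesis
    by (simp add: success_def vimage_def Int_def conj_commute)
qed

end

text \<open>The power constraint is kept apart from measurability because deriving it for the code
  with exchanged users already uses the measurability of that code.\<close>

locale feedback_code = feedback_scheme +
  fixes M1 M2 :: nat
  assumes power1: "(\<Sum>i<N. \<Sum>w1\<in>{1..M1}. \<Sum>w2\<in>{1..M2}.
        \<integral>\<^sup>+ z. ennreal ((cmod (tx1 g11 g12 g21 g22 f1 f2 w1 w2 z i))^2) \<partial>noiseM N)
       \<le> ennreal (real N * real M1 * real M2)"
    and power2: "(\<Sum>i<N. \<Sum>w1\<in>{1..M1}. \<Sum>w2\<in>{1..M2}.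
        \<integral>\<^sup>+ z. ennreal ((cmod (tx2 g11 g12 g21 g22 f1 f2 w1 w2 z i))^2) \<partial>noiseM N)
       \<le> ennreal (real N * real M1 * real M2)"
    and pos: "N > 0" "M1 > 0" "M2 > 0"
begin

definition "W = {1..M1} \<times> {1..M2}"

lemma finite_W [simp]: "finite W" and card_W: "card W = M1 * M2"
  by (simp_all add: W_def)

lemma sum_W: "(\<Sum>w\<in>W. F (fst w) (snd w)) = (\<Sum>w1\<in>{1..M1}. \<Sum>w2\<in>{1..M2}. F w1 w2)"
  by (simp add: W_def sum.cartesian_product split_beta)

definition "n = real N * real M1 * real M2"

lemma n_pos: "n > 0"
  using pos by (simp add: n_def)

text \<open>The expectation over a uniform time, uniform messages and the noise. The target type is
  left open because the powers are real and \<open>corr\<close> is complex.\<close>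

definition avg :: "(complex \<Rightarrow> complex \<Rightarrow> 'b::{banach, second_countable_topology}) \<Rightarrow> 'b" where
  "avg \<phi> = (\<Sum>i<N. \<Sum>w\<in>W.
     \<integral>z. \<phi> (X1 i (fst w) (out (fst w) (snd w) z i)) (X2 i (snd w) (out (fst w) (snd w) z i)) \<partial>noiseM N) /\<^sub>R n"

definition "corr = avg (\<lambda>x y. x * cnj y)"

text \<open>A finite bound on a sum of nonnegative integrals makes each of them finite. This is the
  source of integrability at every single time and message pair, although only the total power is
  constrained.\<close>

lemma integrable_square_aux:
  assumes le: "(\<Sum>i<N. \<Sum>w1\<in>{1..M1}. \<Sum>w2\<in>{1..M2}. \<integral>\<^sup>+ z. ennreal ((cmod (Y i w1 w2 z))\<^sup>2) \<partial>noiseM N)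
       \<le> ennreal (real N * real M1 * real M2)"
    and Y [measurable]: "\<And>i w1 w2. i < N \<Longrightarrow> Y i w1 w2 \<in> borel_measurable (noiseM N)"
  shows "i < N \<Longrightarrow> w \<in> W \<Longrightarrow> integrable (noiseM N) (\<lambda>z. (cmod (Y i (fst w) (snd w) z))\<^sup>2)"
    and "(\<Sum>i<N. \<Sum>w\<in>W. \<integral>z. (cmod (Y i (fst w) (snd w) z))\<^sup>2 \<partial>noiseM N) \<le> n"
proof -
  let ?I = "\<lambda>i w. \<integral>\<^sup>+ z. ennreal ((cmod (Y i (fst w) (snd w) z))\<^sup>2) \<partial>noiseM N"
  have le': "(\<Sum>i<N. \<Sum>w\<in>W. ?I i w) \<le> ennreal n"
    using le by (simp add: sum_W[of "\<lambda>w1 w2. \<integral>\<^sup>+ z. ennreal ((cmod (Y _ w1 w2 z))\<^sup>2) \<partial>noiseM N"] n_def)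
  show int: "integrable (noiseM N) (\<lambda>z. (cmod (Y i (fst w) (snd w) z))\<^sup>2)" if "i < N" "w \<in> W" for i w
  proof (rule integrableI_nonneg)
    have "?I i w \<le> (\<Sum>w\<in>W. ?I i w)"
      using that by (intro member_le_sum) auto
    also have "\<dots> \<le> (\<Sum>i<N. \<Sum>w\<in>W. ?I i w)"
      using that by (intro member_le_sum) auto
    finally show "?I i w < \<infinity>"
      using le' by (simp add: order_le_less_trans[OF order_trans])
  qed (use that in auto)
  have "ennreal (\<Sum>i<N. \<Sum>w\<in>W. \<integral>z. (cmod (Y i (fst w) (snd w) z))\<^sup>2 \<partial>noiseM N) =
     (\<Sum>i<N. \<Sum>w\<in>W. ennreal (\<integral>z. (cmod (Y i (fst w) (snd w) z))\<^sup>2 \<partial>noiseM N))"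
    by (simp add: sum_ennreal sum_nonneg)
  also have "\<dots> = (\<Sum>i<N. \<Sum>w\<in>W. ?I i w)"
    using int by (intro sum.cong refl nn_integral_eq_integral[symmetric]) auto
  finally have eq: "ennreal (\<Sum>i<N. \<Sum>w\<in>W. \<integral>z. (cmod (Y i (fst w) (snd w) z))\<^sup>2 \<partial>noiseM N) =
     (\<Sum>i<N. \<Sum>w\<in>W. ?I i w)" .
  show "(\<Sum>i<N. \<Sum>w\<in>W. \<integral>z. (cmod (Y i (fst w) (snd w) z))\<^sup>2 \<partial>noiseM N) \<le> n"
    using le' n_pos unfolding eq[symmetric] by simp
qed

lemma integrable_X1: "i < N \<Longrightarrow> w \<in> W \<Longrightarrow>
    integrable (noiseM N) (\<lambda>z. (cmod (X1 i (fst w) (out (fst w) (snd w) z i)))\<^sup>2)"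
  and avg_X1: "avg (\<lambda>x y. (cmod x)\<^sup>2) \<le> 1"
  using integrable_square_aux[of "\<lambda>i w1 w2 z. X1 i w1 (out w1 w2 z i)"] power1 n_pos
  by (auto simp: tx_eq avg_def field_simps)

lemma integrable_X2: "i < N \<Longrightarrow> w \<in> W \<Longrightarrow>
    integrable (noiseM N) (\<lambda>z. (cmod (X2 i (snd w) (out (fst w) (snd w) z i)))\<^sup>2)"
  and avg_X2: "avg (\<lambda>x y. (cmod y)\<^sup>2) \<le> 1"
  using integrable_square_aux[of "\<lambda>i w1 w2 z. X2 i w2 (out w1 w2 z i)"] power2 n_pos
  by (auto simp: tx_eq avg_def field_simps)

lemma integrable_X1X2:
  assumes "i < N" "w \<in> W"
  shows "integrable (noiseM N) (\<lambda>z. X1 i (fst w) (out (fst w) (snd w) z i)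
      * cnj (X2 i (snd w) (out (fst w) (snd w) z i)))"
proof (rule Bochner_Integration.integrable_bound[OF
    Bochner_Integration.integrable_add[OF integrable_X1[OF assms] integrable_X2[OF assms]]])
  have "norm (a * cnj b) \<le> norm ((cmod a)\<^sup>2 + (cmod b)\<^sup>2)" for a b
  proof -
    have "cmod a * cmod b \<le> (cmod a)\<^sup>2 + (cmod b)\<^sup>2"
      using sum_squares_bound[of "cmod a" "cmod b"] mult_nonneg_nonneg[OF norm_ge_zero[of a] norm_ge_zero[of b]]
      by linarith
    then show ?thesis
      by (simp add: norm_mult)
  qed
  then show "AE z in noiseM N. norm (X1 i (fst w) (out (fst w) (snd w) z i)
      * cnj (X2 i (snd w) (out (fst w) (snd w) z i))) \<le>
      norm ((cmod (X1 i (fst w) (out (fst w) (snd w) z i)))\<^sup>2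
        + (cmod (X2 i (snd w) (out (fst w) (snd w) z i)))\<^sup>2)"
    by (simp add: norm_mult)
next
  have [measurable]: "(\<lambda>z. out (fst w) (snd w) z i) \<in> noiseM N \<rightarrow>\<^sub>M histM"
    using assms by (intro measurable_out) simp
  have [measurable]: "cnj \<in> borel_measurable borel"
    by (intro borel_measurable_continuous_onI continuous_intros)
  show "(\<lambda>z. X1 i (fst w) (out (fst w) (snd w) z i) * cnj (X2 i (snd w) (out (fst w) (snd w) z i)))
      \<in> borel_measurable (noiseM N)"
    by measurable
qed

lemma has_integral_lin:
  assumes "i < N" "w \<in> W"
  shows "has_bochner_integral (noiseM N)
    (\<lambda>z. (cmod (p * X1 i (fst w) (out (fst w) (snd w) z i)
      + r * X2 i (snd w) (out (fst w) (snd w) z i)))\<^sup>2)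
    ((cmod p)\<^sup>2 * (\<integral>z. (cmod (X1 i (fst w) (out (fst w) (snd w) z i)))\<^sup>2 \<partial>noiseM N)
    + (cmod r)\<^sup>2 * (\<integral>z. (cmod (X2 i (snd w) (out (fst w) (snd w) z i)))\<^sup>2 \<partial>noiseM N)
    + 2 * Re (p * cnj r * (\<integral>z. X1 i (fst w) (out (fst w) (snd w) z i)
      * cnj (X2 i (snd w) (out (fst w) (snd w) z i)) \<partial>noiseM N)))"
  by (intro has_bochner_integral_cmod_lin integrable_X1 integrable_X2 integrable_X1X2 assms)

lemma avg_lin:
  "avg (\<lambda>x y. (cmod (p * x + r * y))\<^sup>2) = (cmod p)\<^sup>2 * avg (\<lambda>x y. (cmod x)\<^sup>2)
     + (cmod r)\<^sup>2 * avg (\<lambda>x y. (cmod y)\<^sup>2) + 2 * Re (p * cnj r * corr)"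
proof -
  define a where "a i w = (\<integral>z. (cmod (X1 i (fst w) (out (fst w) (snd w) z i)))\<^sup>2 \<partial>noiseM N)" for i w
  define b where "b i w = (\<integral>z. (cmod (X2 i (snd w) (out (fst w) (snd w) z i)))\<^sup>2 \<partial>noiseM N)" for i w
  define c where "c i w = (\<integral>z. X1 i (fst w) (out (fst w) (snd w) z i)
      * cnj (X2 i (snd w) (out (fst w) (snd w) z i)) \<partial>noiseM N)" for i w
  have "(\<Sum>i<N. \<Sum>w\<in>W. (cmod p)\<^sup>2 * a i w + (cmod r)\<^sup>2 * b i w + 2 * Re (p * cnj r * c i w)) =
    (cmod p)\<^sup>2 * (\<Sum>i<N. \<Sum>w\<in>W. a i w) + (cmod r)\<^sup>2 * (\<Sum>i<N. \<Sum>w\<in>W. b i w)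
      + 2 * Re (p * cnj r * (\<Sum>i<N. \<Sum>w\<in>W. c i w))"
    by (simp only: sum.distrib sum_distrib_left Re_sum)
  moreover have "corr = (\<Sum>i<N. \<Sum>w\<in>W. c i w) /\<^sub>R n"
    by (simp add: corr_def avg_def c_def)
  moreover have "avg (\<lambda>x y. (cmod (p * x + r * y))\<^sup>2) =
     (\<Sum>i<N. \<Sum>w\<in>W. (cmod p)\<^sup>2 * a i w + (cmod r)\<^sup>2 * b i w + 2 * Re (p * cnj r * c i w)) / n"
    unfolding avg_def a_def b_def c_def real_scaleR_def divide_inverse_commute
    by (intro arg_cong[where f="(*) (inverse n)"] sum.cong refl has_bochner_integral_integral_eq has_integral_lin)
       simp_all
  ultimately show ?thesis
    using n_pos by (simp only: avg_def a_def[symmetric] b_def[symmetric] mult_scaleR_right scaleR_complex.sel)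
       (simp add: field_simps)
qed

lemma avg_lin_nonneg: "avg (\<lambda>x y. (cmod (p * x + r * y))\<^sup>2) \<ge> 0"
  using n_pos by (simp add: avg_def sum_nonneg)

end

section \<open>Gaussian reference laws\<close>

text \<open>The logarithm of the density of \<open>(z1, z2)\<close> under \<open>cgauss2\<close> over that of \<open>(p, q)\<close> under centred
  Gaussians of variances \<open>V\<close> and \<open>S\<close>.\<close>

definition gauss_llr :: "real \<Rightarrow> real \<Rightarrow> complex \<Rightarrow> complex \<Rightarrow> complex \<Rightarrow> complex \<Rightarrow> real" where
  "gauss_llr V S p q z1 z2 =
     ln V + ln S + (cmod p)\<^sup>2 / V + (cmod q)\<^sup>2 / S - (cmod z1)\<^sup>2 - (cmod z2)\<^sup>2"

lemma cgauss_density_ratio: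
  assumes "V > 0" "S > 0"
  shows "cgauss_density 1 z1 * cgauss_density 1 z2 * exp (- gauss_llr V S p q z1 z2) =
    cgauss_density V p * cgauss_density S q"
proof -
  have eq: "- gauss_llr V S p q z1 z2 = - ln V + (- ln S + (- (cmod p)\<^sup>2 / V
      + (- (cmod q)\<^sup>2 / S + ((cmod z1)\<^sup>2 + (cmod z2)\<^sup>2))))"
    by (simp add: gauss_llr_def)
  show ?thesis
    unfolding eq cgauss_density_def exp_add using assms by (simp add: exp_minus field_simps)
qed

context feedback_code
begin

text \<open>The reference channel: \<open>y2\<close> is Gaussian of variance \<open>V\<close> around \<open>a1 x1 + a2 x2\<close>, and given \<open>y2\<close>,
  \<open>y1\<close> is Gaussian of variance \<open>S\<close> around \<open>b1 x1 + b2 x2 + b y2\<close>.\<close>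

definition ref :: "complex \<Rightarrow> complex \<Rightarrow> complex \<Rightarrow> complex \<Rightarrow> complex \<Rightarrow> real \<Rightarrow> real \<Rightarrow> nat \<Rightarrow> nat \<Rightarrow>
    nat \<Rightarrow> (nat \<Rightarrow> complex \<times> complex) \<Rightarrow> complex \<times> complex \<Rightarrow> ennreal" where
  "ref a1 a2 b1 b2 b V S w1 w2 i h y = ennreal (
     cgauss_density V (snd y - (a1 * X1 i w1 h + a2 * X2 i w2 h)) *
     cgauss_density S (fst y - (b1 * X1 i w1 h + b2 * X2 i w2 h + b * snd y)))"

lemma measurable_ref:
  "(\<lambda>x. ref a1 a2 b1 b2 b V S w1 w2 i (fst x) (snd x)) \<in> borel_measurable (histM \<Otimes>\<^sub>M borel)"
proof -
  have [measurable]: "X1 i w1 \<in> borel_measurable histM" "X2 i w2 \<in> borel_measurable histM"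
    by (rule measurable_X)+
  show ?thesis unfolding ref_def by measurable
qed

lemma ref_marginal:
  assumes "V > 0" "S > 0"
  shows "(\<integral>\<^sup>+ u. ref a1 a2 b1 b2 b V S w1 w2 i h (u, v) \<partial>lborel) =
    ennreal (cgauss_density V (v - (a1 * X1 i w1 h + a2 * X2 i w2 h)))"
  using assms
  by (simp add: ref_def ennreal_mult cgauss_density_pos less_imp_le nn_integral_cmult nn_integral_cgauss_density)

lemma ref_total:
  assumes "V > 0" "S > 0"
  shows "(\<integral>\<^sup>+ y. ref a1 a2 b1 b2 b V S w1 w2 i h y \<partial>lborel) = 1"
  using assms measurable_hist_section[OF measurable_ref]
  by (subst nn_integral_lborel_Pair) (simp_all add: ref_marginal nn_integral_cgauss_density)

text \<open>Under the true channel the reference mispredicts \<open>y2\<close> by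
  \<open>(g12 - a1) x1 + (g22 - a2) x2 + z2\<close>, and \<open>y1\<close> given \<open>y2\<close>
  by a combination of the inputs plus \<open>z1 - b z2\<close>. The conditions on \<open>V\<close>
  and \<open>S\<close> say that they dominate the averaged squares of these errors. The two
  normalised error terms are then at most 1 each and cancel against the noise terms, which leaves
  \<open>ln V + ln S\<close> per channel use.\<close>

lemma master_bound:
  assumes VS: "V > 0" "S > 0" and "K > 0"
    and hV: "avg (\<lambda>x y. (cmod ((g12 - a1) * x + (g22 - a2) * y))\<^sup>2) + 1 \<le> V"
    and hS: "avg (\<lambda>x y. (cmod ((g11 - b1 - b * g12) * x + (g21 - b2 - b * g22) * y))\<^sup>2) + 1 + (cmod b)\<^sup>2 \<le> S"
    and count: "(\<Sum>w\<in>W. refint (ref a1 a2 b1 b2 b V S (fst w) (snd w)) N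
        (indicator (correct1 (fst w) \<inter> correct2 (snd w)))) \<le> ennreal K"
  shows "(\<Sum>w\<in>W. measure (noiseM N) (success (fst w) (snd w))) * ln (card W / K)
    \<le> n * (ln V + ln S) + card W * ln 2"
proof -
  let ?x = "\<lambda>w i z. X1 i (fst w) (out (fst w) (snd w) z i)"
  let ?y = "\<lambda>w i z. X2 i (snd w) (out (fst w) (snd w) z i)"
  define pm where "pm w i h = (g12 - a1) * X1 i (fst w) h + (g22 - a2) * X2 i (snd w) h"
    for w :: "nat \<times> nat" and i h
  define qm where "qm w i h = (g11 - b1 - b * g12) * X1 i (fst w) h
      + (g21 - b2 - b * g22) * X2 i (snd w) h" for w :: "nat \<times> nat" and i h
  have [measurable]: "pm w i \<in> borel_measurable histM" "qm w i \<in> borel_measurable histM" for w i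
    using measurable_X unfolding pm_def[abs_def] qm_def[abs_def] by measurable
  \<comment> \<open>The factors 0 and 1 are spelled out so that both arguments match the affine
    noise lemma, with noise coefficients \<open>(0, 1)\<close> and \<open>(1, - b)\<close>.\<close>
  define ll where "ll w i h z = gauss_llr V S (pm w i h + 0 * fst z + 1 * snd z)
      (qm w i h + 1 * fst z + (- b) * snd z) (fst z) (snd z)" for w i h z
  define l where "l w z = (\<Sum>i<N. ll w i (out (fst w) (snd w) z i) (z i))" for w z
  have ll_meas: "(\<lambda>x. ennreal (exp (- ll w i (fst x) (snd x)))) \<in> borel_measurable (histM \<Otimes>\<^sub>M borel)" for w i
    unfolding ll_def gauss_llr_def by measurable
  have ratio: "ennreal (cgauss_density 1 (fst z) * cgauss_density 1 (snd z)) * ennreal (exp (- ll w i h z))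
      = ref a1 a2 b1 b2 b V S (fst w) (snd w) i h (mean (fst w) (snd w) i h + z)" for w i h z
  proof -
    have "snd (mean (fst w) (snd w) i h + z) - (a1 * X1 i (fst w) h + a2 * X2 i (snd w) h)
        = pm w i h + 0 * fst z + 1 * snd z"
      by (simp add: mean_def pm_def algebra_simps)
    moreover have "fst (mean (fst w) (snd w) i h + z)
        - (b1 * X1 i (fst w) h + b2 * X2 i (snd w) h + b * snd (mean (fst w) (snd w) i h + z))
        = qm w i h + 1 * fst z + (- b) * snd z"
      by (simp add: mean_def qm_def algebra_simps)
    ultimately show ?thesis
      unfolding ref_def ll_def
      by (simp only: cgauss_density_ratio[OF VS] ennreal_mult''[OF exp_ge_zero, symmetric])
  qed
  \<comment> \<open>Both mass conditions of the converse become values of \<open>refint\<close>: for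
    the constant 1 and for the indicator of correct decoding.\<close>
  have com: "(\<integral>\<^sup>+ z. ennreal (exp (- l w z)) * F (out (fst w) (snd w) z N) \<partial>noiseM N) =
      refint (ref a1 a2 b1 b2 b V S (fst w) (snd w)) N F" if "F \<in> borel_measurable histM" for F w
    using change_of_measure[of N "mean (fst w) (snd w)" "\<lambda>i h z. ennreal (exp (- ll w i h z))", OF
        measurable_mean ll_meas measurable_ref ratio that]
    by (simp add: l_def sum_negf[symmetric] exp_sum prod_ennreal)
  have int_p: "has_bochner_integral (noiseM N)
      (\<lambda>z. (cmod (pm w i (out (fst w) (snd w) z i) + 0 * fst (z i) + 1 * snd (z i)))\<^sup>2)
      ((\<integral>z. (cmod (pm w i (out (fst w) (snd w) z i)))\<^sup>2 \<partial>noiseM N) + (cmod 0)\<^sup>2 + (cmod 1)\<^sup>2)"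
    and int_q: "has_bochner_integral (noiseM N)
      (\<lambda>z. (cmod (qm w i (out (fst w) (snd w) z i) + 1 * fst (z i) + (- b) * snd (z i)))\<^sup>2)
      ((\<integral>z. (cmod (qm w i (out (fst w) (snd w) z i)))\<^sup>2 \<partial>noiseM N) + (cmod 1)\<^sup>2 + (cmod (- b))\<^sup>2)"
    if "w \<in> W" "i < N" for w i
  proof -
    note lin = has_bochner_integral_iff[THEN iffD1, OF has_integral_lin[OF that(2,1)], THEN conjunct1]
    show "has_bochner_integral (noiseM N)
      (\<lambda>z. (cmod (pm w i (out (fst w) (snd w) z i) + 0 * fst (z i) + 1 * snd (z i)))\<^sup>2)
      ((\<integral>z. (cmod (pm w i (out (fst w) (snd w) z i)))\<^sup>2 \<partial>noiseM N) + (cmod 0)\<^sup>2 + (cmod 1)\<^sup>2)"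
      using that(2) lin by (intro has_integral_noise_affine measurable_mean) (auto simp: pm_def)
    show "has_bochner_integral (noiseM N)
      (\<lambda>z. (cmod (qm w i (out (fst w) (snd w) z i) + 1 * fst (z i) + (- b) * snd (z i)))\<^sup>2)
      ((\<integral>z. (cmod (qm w i (out (fst w) (snd w) z i)))\<^sup>2 \<partial>noiseM N) + (cmod 1)\<^sup>2 + (cmod (- b))\<^sup>2)"
      using that(2) lin by (intro has_integral_noise_affine measurable_mean) (auto simp: qm_def)
  qed
  have int_z: "has_bochner_integral (noiseM N) (\<lambda>z. (cmod (fst (z i)))\<^sup>2) 1"
    "has_bochner_integral (noiseM N) (\<lambda>z. (cmod (snd (z i)))\<^sup>2) 1" if "i < N" for i
    using has_integral_noise_affine[of i N "\<lambda>_ _. (0, 0)" "\<lambda>_. 0" 1 0]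
      has_integral_noise_affine[of i N "\<lambda>_ _. (0, 0)" "\<lambda>_. 0" 0 1] that
    by simp_all
  interpret prob_space "noiseM N" by (rule prob_space_noiseM)
  have int_ll: "has_bochner_integral (noiseM N) (\<lambda>z. ll w i (out (fst w) (snd w) z i) (z i))
      (ln V + ln S + ((\<integral>z. (cmod (pm w i (out (fst w) (snd w) z i)))\<^sup>2 \<partial>noiseM N) + (cmod 0)\<^sup>2 + (cmod 1)\<^sup>2) / V
       + ((\<integral>z. (cmod (qm w i (out (fst w) (snd w) z i)))\<^sup>2 \<partial>noiseM N) + (cmod 1)\<^sup>2 + (cmod (- b))\<^sup>2) / S - 1 - 1)"
    if "w \<in> W" "i < N" for w i
  proof -
    have "has_bochner_integral (noiseM N) (\<lambda>z. c) c" for c :: real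
      using has_bochner_integral_integrable[of "noiseM N" "\<lambda>_. c"] by (simp add: prob_space)
    then show ?thesis
      unfolding ll_def gauss_llr_def
      by (intro has_bochner_integral_add has_bochner_integral_diff has_bochner_integral_divide
          int_p int_q int_z that)
  qed
  have int_l: "has_bochner_integral (noiseM N) (l w) (\<Sum>i<N.
      ln V + ln S + ((\<integral>z. (cmod (pm w i (out (fst w) (snd w) z i)))\<^sup>2 \<partial>noiseM N) + (cmod 0)\<^sup>2 + (cmod 1)\<^sup>2) / V
       + ((\<integral>z. (cmod (qm w i (out (fst w) (snd w) z i)))\<^sup>2 \<partial>noiseM N) + (cmod 1)\<^sup>2 + (cmod (- b))\<^sup>2) / S - 1 - 1)"
    if "w \<in> W" for w
    unfolding l_def[abs_def] using that by (intro has_bochner_integral_sum int_ll) auto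
  have "(\<Sum>w\<in>W. measure (noiseM N) (success (fst w) (snd w))) * ln (card W / K)
     \<le> (\<Sum>w\<in>W. \<integral>z. l w z \<partial>noiseM N) + card W * ln 2"
  proof (rule likelihood_ratio_converse)
    show "integrable (noiseM N) (l w)" if "w \<in> W" for w
      using int_l[OF that] by (simp add: has_bochner_integral_iff)
    show "success (fst w) (snd w) \<in> sets (noiseM N)" for w
      by (rule sets_success)
    show "(\<integral>\<^sup>+ z. ennreal (exp (- l w z)) \<partial>noiseM N) \<le> 1" for w
      using com[of "\<lambda>_. 1" w] refint_one[of N, OF ref_total[OF VS]] by simp
    have "(\<Sum>w\<in>W. \<integral>\<^sup>+ z. ennreal (exp (- l w z)) * indicator (success (fst w) (snd w)) z \<partial>noiseM N) =
      (\<Sum>w\<in>W. \<integral>\<^sup>+ z. ennreal (exp (- l w z))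
        * indicator (correct1 (fst w) \<inter> correct2 (snd w)) (out (fst w) (snd w) z N) \<partial>noiseM N)"
      by (intro sum.cong nn_integral_cong) (auto simp: success_def indicator_def)
    then show "(\<Sum>w\<in>W. \<integral>\<^sup>+ z. ennreal (exp (- l w z)) * indicator (success (fst w) (snd w)) z \<partial>noiseM N) \<le> ennreal K"
      using count by (simp add: com)
  qed (use \<open>K > 0\<close> in \<open>auto intro: prob_space_noiseM\<close>)
  also have "(\<Sum>w\<in>W. \<integral>z. l w z \<partial>noiseM N) =
    (\<Sum>w\<in>W. \<Sum>i<N. ln V + ln S - 2
       + ((\<integral>z. (cmod (pm w i (out (fst w) (snd w) z i)))\<^sup>2 \<partial>noiseM N) + 1) / V
       + ((\<integral>z. (cmod (qm w i (out (fst w) (snd w) z i)))\<^sup>2 \<partial>noiseM N) + (1 + (cmod b)\<^sup>2)) / S)"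
    by (intro sum.cong refl, subst has_bochner_integral_integral_eq[OF int_l])
       (auto intro!: sum.cong simp: algebra_simps)
  also have "\<dots> = (\<Sum>i<N. \<Sum>w\<in>W. ln V + ln S - 2
       + ((\<integral>z. (cmod (pm w i (out (fst w) (snd w) z i)))\<^sup>2 \<partial>noiseM N) + 1) / V
       + ((\<integral>z. (cmod (qm w i (out (fst w) (snd w) z i)))\<^sup>2 \<partial>noiseM N) + (1 + (cmod b)\<^sup>2)) / S)"
    by (rule sum.swap)
  also have "\<dots> = n * (ln V + ln S - 2)
     + ((\<Sum>i<N. \<Sum>w\<in>W. \<integral>z. (cmod (pm w i (out (fst w) (snd w) z i)))\<^sup>2 \<partial>noiseM N) + n) / V
     + ((\<Sum>i<N. \<Sum>w\<in>W. \<integral>z. (cmod (qm w i (out (fst w) (snd w) z i)))\<^sup>2 \<partial>noiseM N) + n * (1 + (cmod b)\<^sup>2)) / S"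
    by (simp only: sum.distrib sum_divide_distrib[symmetric] sum_constant card_W card_lessThan
        n_def of_nat_mult mult.assoc distrib_left mult_1_right)
  also have "(\<Sum>i<N. \<Sum>w\<in>W. \<integral>z. (cmod (pm w i (out (fst w) (snd w) z i)))\<^sup>2 \<partial>noiseM N) =
     n * avg (\<lambda>x y. (cmod ((g12 - a1) * x + (g22 - a2) * y))\<^sup>2)"
    using n_pos by (simp add: avg_def pm_def)
  also have "(\<Sum>i<N. \<Sum>w\<in>W. \<integral>z. (cmod (qm w i (out (fst w) (snd w) z i)))\<^sup>2 \<partial>noiseM N) =
     n * avg (\<lambda>x y. (cmod ((g11 - b1 - b * g12) * x + (g21 - b2 - b * g22) * y))\<^sup>2)"
    using n_pos by (simp add: avg_def qm_def)
  also have "n * (ln V + ln S - 2)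
     + (n * avg (\<lambda>x y. (cmod ((g12 - a1) * x + (g22 - a2) * y))\<^sup>2) + n) / V
     + (n * avg (\<lambda>x y. (cmod ((g11 - b1 - b * g12) * x + (g21 - b2 - b * g22) * y))\<^sup>2) + n * (1 + (cmod b)\<^sup>2)) / S
     = n * (ln V + ln S - 2)
     + n * ((avg (\<lambda>x y. (cmod ((g12 - a1) * x + (g22 - a2) * y))\<^sup>2) + 1) / V)
     + n * ((avg (\<lambda>x y. (cmod ((g11 - b1 - b * g12) * x + (g21 - b2 - b * g22) * y))\<^sup>2) + 1 + (cmod b)\<^sup>2) / S)"
    by (simp add: distrib_left add.assoc)
  also have "\<dots> \<le> n * (ln V + ln S - 2) + n * 1 + n * 1"
    using hV hS VS n_pos by (intro add_mono mult_left_mono order_refl) auto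
  also have "\<dots> = n * (ln V + ln S)"
    by (simp add: algebra_simps)
  finally show ?thesis by simp
qed

end

section \<open>Three of the six bounds\<close>

text \<open>Three of the six inequalities; the other three are the same predicate with the users exchanged.\<close>

definition half_region :: "complex \<Rightarrow> complex \<Rightarrow> complex \<Rightarrow> real \<Rightarrow> real \<Rightarrow> real \<Rightarrow> bool" where
  "half_region g11 g12 g22 \<rho> R1 R2 \<longleftrightarrow>
     R2 \<le> log 2 (1 + (cmod g22)\<^sup>2 + (cmod g12)\<^sup>2 + 2 * \<rho> * sqrt ((cmod g22)\<^sup>2 * (cmod g12)\<^sup>2)) \<and>
     R1 \<le> log 2 (1 + (1 - \<rho>\<^sup>2) * (cmod g12)\<^sup>2)
           + log 2 (1 + (1 - \<rho>\<^sup>2) * (cmod g11)\<^sup>2 / (1 + (1 - \<rho>\<^sup>2) * (cmod g12)\<^sup>2)) \<and>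
     R1 + R2 \<le> log 2 (1 + (1 - \<rho>\<^sup>2) * (cmod g11)\<^sup>2 / (1 + (1 - \<rho>\<^sup>2) * (cmod g12)\<^sup>2))
           + log 2 (1 + (cmod g22)\<^sup>2 + (cmod g12)\<^sup>2 + 2 * \<rho> * sqrt ((cmod g22)\<^sup>2 * (cmod g12)\<^sup>2))"

section \<open>Total reference probability of correct decoding\<close>

context feedback_code
begin

text \<open>A decoder names a single message, so its events of correct decoding are
  disjoint.\<close>

lemma sum_indicator_correct_le:
  assumes "finite A"
  shows "(\<Sum>w\<in>A. indicator (correct1 w) h) \<le> (1 :: ennreal)"
    and "(\<Sum>w\<in>A. indicator (correct2 w) h) \<le> (1 :: ennreal)"
proof -
  have *: "(\<Sum>w\<in>A. if w = k then 1 else 0) \<le> (1 :: ennreal)" for k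
    using assms by (simp add: sum.delta)
  have "(\<Sum>w\<in>A. indicator (correct1 w) h) =
      (\<Sum>w\<in>A. if w = d1 (restrict (fst \<circ> h) {..<N}) then 1 else 0 :: ennreal)"
    by (intro sum.cong) (auto simp: correct1_def)
  with * show "(\<Sum>w\<in>A. indicator (correct1 w) h) \<le> (1 :: ennreal)" by simp
  have "(\<Sum>w\<in>A. indicator (correct2 w) h) =
      (\<Sum>w\<in>A. if w = d2 (restrict (snd \<circ> h) {..<N}) then 1 else 0 :: ennreal)"
    by (intro sum.cong) (auto simp: correct2_def)
  with * show "(\<Sum>w\<in>A. indicator (correct2 w) h) \<le> (1 :: ennreal)" by simp
qed

lemma sum_refint_correct1_le:
  "(\<Sum>w1\<in>{1..M1}. refint (ref 0 a2 0 b2 b V S w1 w2) N (indicator (correct1 w1 \<inter> correct2 w2)))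
    \<le> refint (ref 0 a2 0 b2 b V S 1 w2) N (indicator (correct2 w2))"
proof -
  \<comment> \<open>Message 1 enters only through \<open>X1\<close>, whose coefficients vanish; the
    \<open>1\<close> on the right is an arbitrary placeholder.\<close>
  have eq: "ref 0 a2 0 b2 b V S w1 w2 = ref 0 a2 0 b2 b V S 1 w2" for w1
    by (intro ext) (simp add: ref_def)
  have "(\<Sum>w1\<in>{1..M1}. refint (ref 0 a2 0 b2 b V S w1 w2) N (indicator (correct1 w1 \<inter> correct2 w2)))
      = (\<Sum>w1\<in>{1..M1}. refint (ref 0 a2 0 b2 b V S 1 w2) N (indicator (correct1 w1 \<inter> correct2 w2)))"
    by (intro sum.cong refl arg_cong[where f="\<lambda>q. refint q N _", OF eq])
  also have "\<dots> = refint (ref 0 a2 0 b2 b V S 1 w2) N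
      (\<lambda>h. \<Sum>w1\<in>{1..M1}. indicator (correct1 w1 \<inter> correct2 w2) h)"
    by (rule refint_sum[symmetric])
       (intro measurable_ref borel_measurable_indicator sets.Int measurable_correct)+
  also have "\<dots> \<le> refint (ref 0 a2 0 b2 b V S 1 w2) N (indicator (correct2 w2))"
  proof (rule refint_mono)
    fix h :: "nat \<Rightarrow> complex \<times> complex"
    show "(\<Sum>w1\<in>{1..M1}. indicator (correct1 w1 \<inter> correct2 w2) h) \<le> (indicator (correct2 w2) h :: ennreal)"
      using sum_indicator_correct_le(1)[of "{1..M1}" h]
      by (simp add: indicator_inter_arith sum_distrib_right[symmetric] indicator_def del: sum_constant)
  qed
  finally show ?thesis .
qed

text \<open>With both centre coefficients of \<open>y2\<close> zero its block is i.i.d. Gaussian,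
  even though \<open>y1\<close> may still depend on both messages and on the past.\<close>

lemma refint_correct2_indep:
  assumes "V > 0" "S > 0"
  shows "refint (ref 0 0 b1 b2 b V S w1 w2) N (indicator (correct2 w)) =
     refint (ref 0 0 b1 b2 b V S 1 1) N (indicator (correct2 w))"
proof -
  define F :: "(nat \<Rightarrow> complex) \<Rightarrow> ennreal" where "F = indicator {g. d2 (restrict g {..<N}) = w}"
  have "(\<lambda>g. restrict g {..<N}) \<in> PiM UNIV (\<lambda>_. borel) \<rightarrow>\<^sub>M PiM {..<N} (\<lambda>_. borel :: complex measure)"
    by (intro measurable_restrict_subset) simp
  from measurable_sets[OF measurable_compose[OF this d2], of "{w}"]
  have "{g. d2 (restrict g {..<N}) = w} \<in> sets (PiM UNIV (\<lambda>_. borel))"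
    by (simp add: vimage_def space_PiM)
  then have F: "F \<in> borel_measurable (PiM UNIV (\<lambda>_. borel))"
    unfolding F_def by (rule borel_measurable_indicator)
  have eq: "indicator (correct2 w) = (\<lambda>h :: nat \<Rightarrow> complex \<times> complex. F (snd \<circ> h))"
    by (auto simp: F_def correct2_def indicator_def)
  show ?thesis
    unfolding eq
    by (rule refint_marginal_snd[where r="\<lambda>_ v. ennreal (cgauss_density V v)"])
       (simp_all add: measurable_ref ref_marginal assms F)
qed

lemma sum_refint_correct2_le:
  assumes "V > 0" "S > 0"
  shows "(\<Sum>w2\<in>{1..M2}. refint (ref 0 0 b1 b2 b V S w1 w2) N (indicator (correct2 w2))) \<le> 1"
proof -
  have "(\<Sum>w2\<in>{1..M2}. refint (ref 0 0 b1 b2 b V S w1 w2) N (indicator (correct2 w2))) =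
      (\<Sum>w2\<in>{1..M2}. refint (ref 0 0 b1 b2 b V S 1 1) N (indicator (correct2 w2)))"
    by (intro sum.cong refl refint_correct2_indep assms)
  also have "\<dots> = refint (ref 0 0 b1 b2 b V S 1 1) N (\<lambda>h. \<Sum>w2\<in>{1..M2}. indicator (correct2 w2) h)"
    by (rule refint_sum[symmetric])
       (intro measurable_ref borel_measurable_indicator measurable_correct)+
  also have "\<dots> \<le> refint (ref 0 0 b1 b2 b V S 1 1) N (\<lambda>_. 1)"
    by (intro refint_mono sum_indicator_correct_le) simp
  also have "\<dots> = 1"
    by (intro refint_one ref_total assms)
  finally show ?thesis .
qed

text \<open>The sum over message 1 is bounded while \<open>correct2\<close> is retained, and only
  then the sum over message 2. The resulting bound is 1 here, and \<open>M2\<close> and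
  \<open>M1\<close> in the two single-user counts below, so \<open>card W / K\<close> becomes
  \<open>M1 * M2\<close>, \<open>M1\<close> and \<open>M2\<close> respectively.\<close>

lemma count_sum:
  assumes "V > 0" "S > 0"
  shows "(\<Sum>w\<in>W. refint (ref 0 0 0 b2 b V S (fst w) (snd w)) N
        (indicator (correct1 (fst w) \<inter> correct2 (snd w)))) \<le> ennreal 1"
proof -
  have "(\<Sum>w\<in>W. refint (ref 0 0 0 b2 b V S (fst w) (snd w)) N
        (indicator (correct1 (fst w) \<inter> correct2 (snd w)))) =
     (\<Sum>w2\<in>{1..M2}. \<Sum>w1\<in>{1..M1}. refint (ref 0 0 0 b2 b V S w1 w2) N (indicator (correct1 w1 \<inter> correct2 w2)))"
    by (subst sum_W, rule sum.swap)
  also have "\<dots> \<le> (\<Sum>w2\<in>{1..M2}. refint (ref 0 0 0 b2 b V S 1 w2) N (indicator (correct2 w2)))"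
    by (intro sum_mono sum_refint_correct1_le)
  also have "\<dots> \<le> 1"
    by (rule sum_refint_correct2_le[OF assms])
  finally show ?thesis by simp
qed

lemma count_user1:
  assumes "V > 0" "S > 0"
  shows "(\<Sum>w\<in>W. refint (ref 0 a2 0 b2 b V S (fst w) (snd w)) N
        (indicator (correct1 (fst w) \<inter> correct2 (snd w)))) \<le> ennreal M2"
proof -
  have "(\<Sum>w\<in>W. refint (ref 0 a2 0 b2 b V S (fst w) (snd w)) N
        (indicator (correct1 (fst w) \<inter> correct2 (snd w)))) =
     (\<Sum>w2\<in>{1..M2}. \<Sum>w1\<in>{1..M1}. refint (ref 0 a2 0 b2 b V S w1 w2) N (indicator (correct1 w1 \<inter> correct2 w2)))"
    by (subst sum_W, rule sum.swap)
  also have "\<dots> \<le> (\<Sum>w2\<in>{1..M2}. refint (ref 0 a2 0 b2 b V S 1 w2) N (\<lambda>_. 1))"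
    by (intro sum_mono order_trans[OF sum_refint_correct1_le] refint_mono) (simp add: indicator_def)
  also have "\<dots> = ennreal M2"
    using refint_one[of N, OF ref_total[OF assms]] by (simp add: ennreal_of_nat_eq_real_of_nat)
  finally show ?thesis .
qed

lemma count_user2:
  assumes "V > 0" "S > 0"
  shows "(\<Sum>w\<in>W. refint (ref 0 0 b1 b2 b V S (fst w) (snd w)) N
        (indicator (correct1 (fst w) \<inter> correct2 (snd w)))) \<le> ennreal M1"
proof -
  have "(\<Sum>w\<in>W. refint (ref 0 0 b1 b2 b V S (fst w) (snd w)) N
        (indicator (correct1 (fst w) \<inter> correct2 (snd w)))) =
     (\<Sum>w1\<in>{1..M1}. \<Sum>w2\<in>{1..M2}. refint (ref 0 0 b1 b2 b V S w1 w2) N (indicator (correct1 w1 \<inter> correct2 w2)))"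
    by (rule sum_W)
  also have "\<dots> \<le> (\<Sum>w1\<in>{1..M1}. \<Sum>w2\<in>{1..M2}. refint (ref 0 0 b1 b2 b V S w1 w2) N (indicator (correct2 w2)))"
    by (intro sum_mono refint_mono) (simp add: indicator_def)
  also have "\<dots> \<le> (\<Sum>w1\<in>{1..M1}. 1)"
    by (intro sum_mono sum_refint_correct2_le assms)
  also have "\<dots> = ennreal M1"
    by (simp add: ennreal_of_nat_eq_real_of_nat)
  finally show ?thesis .
qed

section \<open>From correct decoding to rates\<close>

definition "psucc = (\<Sum>w\<in>W. measure (noiseM N) (success (fst w) (snd w))) / card W"

lemma psucc_nonneg: "psucc \<ge> 0"
  by (simp add: psucc_def sum_nonneg)

text \<open>Division by \<open>n * ln 2\<close> turns the \<open>ln 2\<close> lost in the converse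
  into \<open>1 / N\<close>; the success probability remains as a factor of the rate.\<close>

lemma master_log:
  fixes R :: real
  assumes VS: "V > 0" "S > 0" and "K > 0"
    and "avg (\<lambda>x y. (cmod ((g12 - a1) * x + (g22 - a2) * y))\<^sup>2) + 1 \<le> V"
    and "avg (\<lambda>x y. (cmod ((g11 - b1 - b * g12) * x + (g21 - b2 - b * g22) * y))\<^sup>2) + 1 + (cmod b)\<^sup>2 \<le> S"
    and "(\<Sum>w\<in>W. refint (ref a1 a2 b1 b2 b V S (fst w) (snd w)) N
        (indicator (correct1 (fst w) \<inter> correct2 (snd w)))) \<le> ennreal K"
    and R: "2 powr (N * R) \<le> card W / K"
  shows "psucc * R - 1 / N \<le> log 2 V + log 2 S"
proof -
  have cW: "card W > 0" "n = N * card W"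
    using pos by (simp_all add: card_W n_def)
  have "N * R * ln 2 \<le> ln (card W / K)"
    using R by (metis ln_powr ln_mono powr_gt_zero zero_less_numeral zero_neq_numeral mult.commute)
  then have "card W * psucc * (N * R * ln 2) \<le> card W * psucc * ln (card W / K)"
    by (intro mult_left_mono) (simp_all add: psucc_nonneg)
  also have "card W * psucc = (\<Sum>w\<in>W. measure (noiseM N) (success (fst w) (snd w)))"
    using cW by (simp add: psucc_def)
  also have "\<dots> * ln (card W / K) \<le> n * (ln V + ln S) + card W * ln 2"
    by (rule master_bound) fact+
  finally have "(\<Sum>w\<in>W. measure (noiseM N) (success (fst w) (snd w))) * (N * R * ln 2)
      \<le> n * (ln V + ln S) + card W * ln 2" .
  also have "(\<Sum>w\<in>W. measure (noiseM N) (success (fst w) (snd w))) = card W * psucc"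
    using cW by (simp add: psucc_def)
  finally have "real (card W) * N * (psucc * R * ln 2 - ln 2 / N) \<le> real (card W) * N * (ln V + ln S)"
    using cW pos by (simp add: algebra_simps)
  then have "psucc * R * ln 2 - ln 2 / N \<le> ln V + ln S"
    using cW pos by (simp add: mult_le_cancel_left_pos)
  then show ?thesis
    by (simp add: log_def field_simps add_divide_distrib[symmetric] pos)
qed

text \<open>The residual of input 1 given input 2. Using \<open>corr\<close> itself as regression coefficient, rather than the
  optimal \<open>corr\<close> divided by the power of input 2, avoids a division and loses nothing, the powers being at most 1.\<close>

lemma avg_innovation:
  "avg (\<lambda>x y. (cmod (p * x + (- p * corr) * y))\<^sup>2) \<le> (cmod p)\<^sup>2 * (1 - (cmod corr)\<^sup>2)"
proof -
  have "Re (p * cnj (- p * corr) * corr) = - ((cmod p)\<^sup>2 * (cmod corr)\<^sup>2)"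
    unfolding cmod_power2 by (simp add: power2_eq_square algebra_simps)
  then have "avg (\<lambda>x y. (cmod (p * x + (- p * corr) * y))\<^sup>2) =
     (cmod p)\<^sup>2 * avg (\<lambda>x y. (cmod x)\<^sup>2)
     + (cmod p)\<^sup>2 * (cmod corr)\<^sup>2 * avg (\<lambda>x y. (cmod y)\<^sup>2) - 2 * ((cmod p)\<^sup>2 * (cmod corr)\<^sup>2)"
    unfolding avg_lin by (simp add: norm_mult power_mult_distrib)
  also have "\<dots> \<le> (cmod p)\<^sup>2 * 1 + (cmod p)\<^sup>2 * (cmod corr)\<^sup>2 * 1 - 2 * ((cmod p)\<^sup>2 * (cmod corr)\<^sup>2)"
    by (intro diff_right_mono add_mono mult_left_mono avg_X1 avg_X2) auto
  finally show ?thesis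
    by (simp add: algebra_simps)
qed

text \<open>Cauchy-Schwarz for the averaged inner product, read off from the nonnegativity of the
  residual of input 1.\<close>

lemma corr_le_1: "cmod corr \<le> 1"
proof -
  have "0 \<le> (cmod 1)\<^sup>2 * (1 - (cmod corr)\<^sup>2)"
    using avg_innovation[of 1] avg_lin_nonneg[of 1 "- 1 * corr"] by (rule order_trans[rotated])
  then show ?thesis
    by (simp add: power_le_one_iff abs_square_le_1)
qed

text \<open>The phase of \<open>p * cnj q * corr\<close> is not controlled, so its real part is
  replaced by its modulus; this is how a real nonnegative rho arises.\<close>

lemma avg_received:
  "avg (\<lambda>x y. (cmod (p * x + q * y))\<^sup>2) \<le> (cmod q)\<^sup>2 + (cmod p)\<^sup>2 + 2 * cmod corr * sqrt ((cmod q)\<^sup>2 * (cmod p)\<^sup>2)"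
proof -
  have "Re (p * cnj q * corr) \<le> cmod corr * (cmod q * cmod p)"
    using complex_Re_le_cmod[of "p * cnj q * corr"] by (simp add: norm_mult mult_ac)
  moreover have "(cmod p)\<^sup>2 * avg (\<lambda>x y. (cmod x)\<^sup>2) \<le> (cmod p)\<^sup>2 * 1"
    "(cmod q)\<^sup>2 * avg (\<lambda>x y. (cmod y)\<^sup>2) \<le> (cmod q)\<^sup>2 * 1"
    by (intro mult_left_mono avg_X1 avg_X2; simp)+
  ultimately show ?thesis
    unfolding avg_lin by (simp add: real_sqrt_mult)
qed

text \<open>\<open>V\<close> bounds the power of \<open>y2\<close>, \<open>D\<close> its residual
  given input 2, and \<open>S\<close> the residual of \<open>y1\<close> given input 2 and
  \<open>y2\<close>. The pairs \<open>(V, 1)\<close>, \<open>(D, S)\<close> and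
  \<open>(V, S)\<close> yield the bounds on \<open>R2\<close>, \<open>R1\<close> and
  \<open>R1 + R2\<close>.\<close>

lemma half_region_code:
  fixes R1 R2 :: real
  assumes R1: "2 powr (N * R1) \<le> M1" and R2: "2 powr (N * R2) \<le> M2"
  shows "half_region g11 g12 g22 (cmod corr) (psucc * R1 - 1 / N) (psucc * R2 - 1 / N)"
proof -
  define \<tau> where "\<tau> = 1 - (cmod corr)\<^sup>2"
  define D where "D = 1 + \<tau> * (cmod g12)\<^sup>2"
  define V where "V = 1 + (cmod g22)\<^sup>2 + (cmod g12)\<^sup>2 + 2 * cmod corr * sqrt ((cmod g22)\<^sup>2 * (cmod g12)\<^sup>2)"
  define S where "S = 1 + \<tau> * (cmod g11)\<^sup>2 / D"
  \<comment> \<open>the least-squares coefficient of \<open>g11 x + z1\<close> on \<open>g12 x + z2\<close> for an input of variance \<open>\<tau>\<close>\<close>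
  define b where "b = \<tau> * g11 * cnj g12 / D"
  define p where "p = g11 - b * g12"
  have \<tau>: "\<tau> \<ge> 0"
    using corr_le_1 by (simp add: \<tau>_def abs_square_le_1)
  then have D: "D > 0"
    by (simp add: D_def add_pos_nonneg)
  have V: "V > 0"
    unfolding V_def by (intro add_pos_nonneg) auto
  have S: "S > 0"
    unfolding S_def using \<tau> D by (intro add_pos_nonneg) auto
  have p: "p = g11 / D"
  proof -
    have "of_real D = 1 + of_real \<tau> * (g12 * cnj g12)"
      by (simp add: D_def complex_norm_square[symmetric])
    moreover have "b * of_real D = of_real \<tau> * g11 * cnj g12"
      using D by (simp add: b_def)
    moreover have "p * of_real D = g11 * of_real D - (b * of_real D) * g12"
      by (simp add: p_def algebra_simps)
    ultimately have "p * of_real D = g11"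
      by (simp add: algebra_simps)
    then show ?thesis
      using D by (simp add: field_simps)
  qed
  have S_eq: "(cmod p)\<^sup>2 * \<tau> + 1 + (cmod b)\<^sup>2 = S"
  proof -
    have "(cmod p)\<^sup>2 * \<tau> + (cmod b)\<^sup>2 = \<tau> * (cmod g11)\<^sup>2 * (1 + \<tau> * (cmod g12)\<^sup>2) / D\<^sup>2"
      using \<tau> D by (simp add: p b_def norm_divide norm_mult power_divide power_mult_distrib
          add_divide_distrib[symmetric] power2_eq_square algebra_simps)
    also have "\<dots> = \<tau> * (cmod g11)\<^sup>2 / D"
      unfolding D_def[symmetric] using D by (simp add: power2_eq_square)
    finally show ?thesis
      by (simp add: S_def)
  qed
  have received: "avg (\<lambda>x y. (cmod ((g12 - 0) * x + (g22 - 0) * y))\<^sup>2) + 1 \<le> V"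
    using avg_received[of g12 g22] by (simp add: V_def)
  \<comment> \<open>The coefficient of input 2 is chosen so that the input part of the error is
    \<open>p\<close> times (input 1 minus \<open>corr\<close> times input 2), as
    \<open>avg_innovation\<close> requires.\<close>
  have residual1: "avg (\<lambda>x y. (cmod ((g11 - 0 - b * g12) * x
       + (g21 - (p * corr + g21 - b * g22) - b * g22) * y))\<^sup>2) + 1 + (cmod b)\<^sup>2 \<le> S"
    using avg_innovation[of p] S_eq by (simp add: p_def[symmetric] \<tau>_def)
  have residual2: "avg (\<lambda>x y. (cmod ((g12 - 0) * x + (g22 - (g12 * corr + g22)) * y))\<^sup>2) + 1 \<le> D"
    using avg_innovation[of g12] by (simp add: \<tau>_def D_def mult.commute)
  \<comment> \<open>For \<open>R2\<close> the reference keeps the true law of \<open>y1\<close>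
    given the inputs; its variance 1 adds nothing to the logarithm.\<close>
  have noise_only: "avg (\<lambda>x y. (cmod ((g11 - g11 - 0 * g12) * x
       + (g21 - g21 - 0 * g22) * y))\<^sup>2) + 1 + (cmod 0)\<^sup>2 \<le> (1 :: real)"
    by (simp add: avg_def)
  have "psucc * R2 - 1 / N \<le> log 2 V + log 2 1"
    by (rule master_log[OF V zero_less_one _ received noise_only count_user2[OF V zero_less_one]])
       (use pos R2 in \<open>auto simp: card_W\<close>)
  moreover have "psucc * R1 - 1 / N \<le> log 2 D + log 2 S"
    by (rule master_log[OF D S _ residual2 residual1 count_user1[OF D S]])
       (use pos R1 in \<open>auto simp: card_W\<close>)
  moreover have "psucc * (R1 + R2) - 1 / N \<le> log 2 V + log 2 S"
  proof (rule master_log[OF V S _ received residual1 count_sum[OF V S]])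
    have "2 powr (N * (R1 + R2)) = 2 powr (N * R1) * 2 powr (N * R2)"
      by (simp add: distrib_left powr_add)
    also have "\<dots> \<le> M1 * M2"
      using mult_mono[OF R1 R2] by simp
    finally show "2 powr (N * (R1 + R2)) \<le> card W / 1"
      by (simp add: card_W)
  qed simp
  \<comment> \<open>Both rates are lowered by \<open>1 / N\<close> while the sum bound loses
    \<open>1 / N\<close> only once, so nonnegativity of \<open>1 / N\<close> suffices for the
    sum.\<close>
  moreover have "1 / real N \<ge> 0" "log 2 (1 :: real) = 0"
    by simp_all
  ultimately show ?thesis
    unfolding half_region_def V_def[symmetric] \<tau>_def[symmetric] D_def[symmetric] S_def[symmetric]
      distrib_left
    by (intro conjI; linarith)
qed

end

section \<open>Exchanging the users and passing to the limit\<close>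

text \<open>\<open>compose\<close> leaves the result undefined from index \<open>N\<close> on, as
  membership in the product space over \<open>{..<N}\<close> demands.\<close>

definition swap_noise :: "nat \<Rightarrow> (nat \<Rightarrow> complex \<times> complex) \<Rightarrow> nat \<Rightarrow> complex \<times> complex" where
  "swap_noise N = compose {..<N} prod.swap"

lemma distr_cgauss2_swap: "distr cgauss2 cgauss2 prod.swap = cgauss2"
proof -
  interpret prob_space cgauss by (rule prob_space_cgauss)
  interpret pair_prob_space cgauss cgauss ..
  have swap: "prod.swap = (\<lambda>(x, y). (y, x))"
    by auto
  show ?thesis
    unfolding cgauss2_def swap by (rule distr_pair_swap[symmetric])
qed

lemma measurable_swap_noise [measurable]: "swap_noise N \<in> noiseM N \<rightarrow>\<^sub>M noiseM N"
proof -
  have [measurable]: "prod.swap \<in> cgauss2 \<rightarrow>\<^sub>M cgauss2"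
    unfolding cgauss2_def prod.swap_def by measurable
  show ?thesis
    unfolding swap_noise_def compose_def noiseM_eq by measurable
qed

lemma distr_swap_noise: "distr (noiseM N) (noiseM N) (swap_noise N) = noiseM N"
proof -
  have "prod.swap \<in> cgauss2 \<rightarrow>\<^sub>M cgauss2"
    unfolding cgauss2_def prod.swap_def by measurable
  then have "distr (noiseM N) (noiseM N) (swap_noise N) = PiM {..<N} (\<lambda>_. distr cgauss2 cgauss2 prod.swap)"
    unfolding noiseM_eq swap_noise_def
    by (intro distr_PiM_finite_prob_space' prob_space_cgauss2) auto
  then show ?thesis
    by (simp add: distr_cgauss2_swap noiseM_eq)
qed

lemma hist_swap:
  "i \<le> N \<Longrightarrow> hist g22 g21 g12 g11 f2 f1 w2 w1 (swap_noise N z) i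
     = prod.swap \<circ> hist g11 g12 g21 g22 f1 f2 w1 w2 z i"
proof (induction i)
  case (Suc i)
  have swap: "fst \<circ> (prod.swap \<circ> h) = snd \<circ> h" "snd \<circ> (prod.swap \<circ> h) = fst \<circ> h"
    for h :: "nat \<Rightarrow> complex \<times> complex"
    by auto
  have z: "swap_noise N z i = prod.swap (z i)"
    using Suc.prems by (simp add: swap_noise_def compose_def)
  have IH: "hist g22 g21 g12 g11 f2 f1 w2 w1 (swap_noise N z) i
      = prod.swap \<circ> hist g11 g12 g21 g22 f1 f2 w1 w2 z i"
    using Suc.prems by (intro Suc.IH) simp
  show ?case
    unfolding hist.simps IH Let_def swap by (auto simp: z fun_eq_iff)
qed auto

lemma tx_swap:
  assumes "i \<le> N"
  shows "tx1 g22 g21 g12 g11 f2 f1 w2 w1 (swap_noise N z) i = tx2 g11 g12 g21 g22 f1 f2 w1 w2 z i"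
    and "tx2 g22 g21 g12 g11 f2 f1 w2 w1 (swap_noise N z) i = tx1 g11 g12 g21 g22 f1 f2 w1 w2 z i"
proof -
  have swap: "fst \<circ> (prod.swap \<circ> h) = snd \<circ> h" "snd \<circ> (prod.swap \<circ> h) = fst \<circ> h"
    for h :: "nat \<Rightarrow> complex \<times> complex"
    by auto
  show "tx1 g22 g21 g12 g11 f2 f1 w2 w1 (swap_noise N z) i = tx2 g11 g12 g21 g22 f1 f2 w1 w2 z i"
    "tx2 g22 g21 g12 g11 f2 f1 w2 w1 (swap_noise N z) i = tx1 g11 g12 g21 g22 f1 f2 w1 w2 z i"
    unfolding tx1_def tx2_def hist_swap[OF assms] swap by simp_all
qed

lemma (in feedback_scheme) feedback_scheme_swap: "feedback_scheme f2 f1 d2 d1 N"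
  using f1 f2 d1 d2 by unfold_locales

lemma (in feedback_scheme) measurable_tx:
  assumes "i \<le> N"
  shows "(\<lambda>z. tx1 g11 g12 g21 g22 f1 f2 w1 w2 z i) \<in> borel_measurable (noiseM N)"
    and "(\<lambda>z. tx2 g11 g12 g21 g22 f1 f2 w1 w2 z i) \<in> borel_measurable (noiseM N)"
  unfolding tx_eq
  by (rule measurable_compose[OF measurable_out[OF assms] measurable_X(1)]
      measurable_compose[OF measurable_out[OF assms] measurable_X(2)])+

context feedback_code
begin

text \<open>Fed with exchanged noise, the exchanged code sends the original inputs with the roles of
  the users reversed, and the noise law is invariant under the exchange.\<close>

lemma feedback_code_swap: "feedback_code g22 g21 g12 g11 f2 f1 d2 d1 N M2 M1"
proof -
  interpret sw: feedback_scheme g22 g21 g12 g11 f2 f1 d2 d1 N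
    by (rule feedback_scheme_swap)
  have swap: "(\<integral>\<^sup>+ z. ennreal ((cmod (Y z))\<^sup>2) \<partial>noiseM N) =
      (\<integral>\<^sup>+ z. ennreal ((cmod (Y (swap_noise N z)))\<^sup>2) \<partial>noiseM N)"
    if [measurable]: "Y \<in> borel_measurable (noiseM N)" for Y :: "(nat \<Rightarrow> complex \<times> complex) \<Rightarrow> complex"
    by (subst distr_swap_noise[symmetric], subst nn_integral_distr) auto
  have "(\<Sum>i<N. \<Sum>w1\<in>{1..M2}. \<Sum>w2\<in>{1..M1}.
      \<integral>\<^sup>+ z. ennreal ((cmod (tx1 g22 g21 g12 g11 f2 f1 w1 w2 z i))\<^sup>2) \<partial>noiseM N) =
    (\<Sum>i<N. \<Sum>w1\<in>{1..M2}. \<Sum>w2\<in>{1..M1}.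
      \<integral>\<^sup>+ z. ennreal ((cmod (tx2 g11 g12 g21 g22 f1 f2 w2 w1 z i))\<^sup>2) \<partial>noiseM N)"
    by (intro sum.cong refl, subst swap) (simp_all add: tx_swap sw.measurable_tx)
  also have "\<dots> = (\<Sum>i<N. \<Sum>w1\<in>{1..M1}. \<Sum>w2\<in>{1..M2}.
      \<integral>\<^sup>+ z. ennreal ((cmod (tx2 g11 g12 g21 g22 f1 f2 w1 w2 z i))\<^sup>2) \<partial>noiseM N)"
    by (intro sum.cong refl sum.swap)
  also have "\<dots> \<le> ennreal (real N * real M2 * real M1)"
    using power2 by (simp add: mult_ac)
  finally have p1: "(\<Sum>i<N. \<Sum>w1\<in>{1..M2}. \<Sum>w2\<in>{1..M1}.
      \<integral>\<^sup>+ z. ennreal ((cmod (tx1 g22 g21 g12 g11 f2 f1 w1 w2 z i))\<^sup>2) \<partial>noiseM N)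
      \<le> ennreal (real N * real M2 * real M1)" .
  have "(\<Sum>i<N. \<Sum>w1\<in>{1..M2}. \<Sum>w2\<in>{1..M1}.
      \<integral>\<^sup>+ z. ennreal ((cmod (tx2 g22 g21 g12 g11 f2 f1 w1 w2 z i))\<^sup>2) \<partial>noiseM N) =
    (\<Sum>i<N. \<Sum>w1\<in>{1..M2}. \<Sum>w2\<in>{1..M1}.
      \<integral>\<^sup>+ z. ennreal ((cmod (tx1 g11 g12 g21 g22 f1 f2 w2 w1 z i))\<^sup>2) \<partial>noiseM N)"
    by (intro sum.cong refl, subst swap) (simp_all add: tx_swap sw.measurable_tx)
  also have "\<dots> = (\<Sum>i<N. \<Sum>w1\<in>{1..M1}. \<Sum>w2\<in>{1..M2}.
      \<integral>\<^sup>+ z. ennreal ((cmod (tx1 g11 g12 g21 g22 f1 f2 w1 w2 z i))\<^sup>2) \<partial>noiseM N)"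
    by (intro sum.cong refl sum.swap)
  also have "\<dots> \<le> ennreal (real N * real M2 * real M1)"
    using power1 by (simp add: mult_ac)
  finally have p2: "(\<Sum>i<N. \<Sum>w1\<in>{1..M2}. \<Sum>w2\<in>{1..M1}.
      \<integral>\<^sup>+ z. ennreal ((cmod (tx2 g22 g21 g12 g11 f2 f1 w1 w2 z i))\<^sup>2) \<partial>noiseM N)
      \<le> ennreal (real N * real M2 * real M1)" .
  show ?thesis
    using p1 p2 pos by unfold_locales
qed

text \<open>A form in terms of \<open>tx1\<close> and \<open>tx2\<close>, for which the exchange of
  users is available.\<close>

lemma corr_eq: "corr = (\<Sum>i<N. \<Sum>w1\<in>{1..M1}. \<Sum>w2\<in>{1..M2}.
    \<integral>z. tx1 g11 g12 g21 g22 f1 f2 w1 w2 z i * cnj (tx2 g11 g12 g21 g22 f1 f2 w1 w2 z i) \<partial>noiseM N) /\<^sub>R n"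
  unfolding corr_def avg_def tx_eq
  by (subst sum_W[of "\<lambda>w1 w2. \<integral>z. X1 _ w1 (out w1 w2 z _) * cnj (X2 _ w2 (out w1 w2 z _)) \<partial>noiseM N"]) simp

lemma success_eq: "success w1 w2 = {z \<in> space (noiseM N).
    d1 (restrict (fst \<circ> hist g11 g12 g21 g22 f1 f2 w1 w2 z N) {..<N}) = w1 \<and>
    d2 (restrict (snd \<circ> hist g11 g12 g21 g22 f1 f2 w1 w2 z N) {..<N}) = w2}"
  by (auto simp: success_def correct1_def correct2_def hist_eq)

lemma psucc_eq: "psucc = 1 - (\<Sum>w1\<in>{1..M1}. \<Sum>w2\<in>{1..M2}. measure (noiseM N)
    {z \<in> space (noiseM N).
       d1 (restrict (fst \<circ> hist g11 g12 g21 g22 f1 f2 w1 w2 z N) {..<N}) \<noteq> w1 \<or>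
       d2 (restrict (snd \<circ> hist g11 g12 g21 g22 f1 f2 w1 w2 z N) {..<N}) \<noteq> w2}) / (real M1 * real M2)"
proof -
  interpret prob_space "noiseM N" by (rule prob_space_noiseM)
  have "{z \<in> space (noiseM N).
       d1 (restrict (fst \<circ> hist g11 g12 g21 g22 f1 f2 w1 w2 z N) {..<N}) \<noteq> w1 \<or>
       d2 (restrict (snd \<circ> hist g11 g12 g21 g22 f1 f2 w1 w2 z N) {..<N}) \<noteq> w2}
     = space (noiseM N) - success w1 w2" for w1 w2
    by (auto simp: success_eq)
  then have *: "measure (noiseM N) {z \<in> space (noiseM N).
       d1 (restrict (fst \<circ> hist g11 g12 g21 g22 f1 f2 w1 w2 z N) {..<N}) \<noteq> w1 \<or>
       d2 (restrict (snd \<circ> hist g11 g12 g21 g22 f1 f2 w1 w2 z N) {..<N}) \<noteq> w2}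
     = 1 - measure (noiseM N) (success w1 w2)" for w1 w2
    by (simp add: prob_compl sets_success)
  have "psucc = (\<Sum>w1\<in>{1..M1}. \<Sum>w2\<in>{1..M2}. measure (noiseM N) (success w1 w2)) / (real M1 * real M2)"
    by (simp add: psucc_def card_W sum_W[of "\<lambda>w1 w2. measure (noiseM N) (success w1 w2)"])
  then show ?thesis
    using pos unfolding * by (simp add: sum_subtractf diff_divide_distrib)
qed

text \<open>Exchanging the users conjugates \<open>corr\<close> and preserves the success
  probability, so both halves hold with the same rho and the same reduced rates.\<close>

lemma half_region_code_swap:
  fixes R1 R2 :: real
  assumes R1: "2 powr (N * R1) \<le> M1" and R2: "2 powr (N * R2) \<le> M2"
  shows "half_region g22 g21 g11 (cmod corr) (psucc * R2 - 1 / N) (psucc * R1 - 1 / N)"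
proof -
  interpret sw: feedback_code g22 g21 g12 g11 f2 f1 d2 d1 N M2 M1
    by (rule feedback_code_swap)
  have "measure (noiseM N) (sw.success w2 w1) = measure (noiseM N) (success w1 w2)" for w1 w2
  proof -
    have swap: "fst \<circ> (prod.swap \<circ> h) = snd \<circ> h" "snd \<circ> (prod.swap \<circ> h) = fst \<circ> h"
      for h :: "nat \<Rightarrow> complex \<times> complex"
      by auto
    have "measure (noiseM N) (sw.success w2 w1) =
        measure (distr (noiseM N) (noiseM N) (swap_noise N)) (sw.success w2 w1)"
      by (simp add: distr_swap_noise)
    also have "\<dots> = measure (noiseM N) (swap_noise N -` sw.success w2 w1 \<inter> space (noiseM N))"
      by (rule measure_distr[OF measurable_swap_noise sw.sets_success])
    also have "swap_noise N -` sw.success w2 w1 \<inter> space (noiseM N) = success w1 w2"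
      using measurable_space[OF measurable_swap_noise[of N]]
      by (auto simp: success_eq sw.success_eq hist_swap swap)
    finally show ?thesis .
  qed
  then have "(\<Sum>w\<in>sw.W. measure (noiseM N) (sw.success (fst w) (snd w))) =
      (\<Sum>w\<in>W. measure (noiseM N) (success (fst w) (snd w)))"
    unfolding sum_W[of "\<lambda>w1 w2. measure (noiseM N) (success w1 w2)"]
      sw.sum_W[of "\<lambda>w1 w2. measure (noiseM N) (sw.success w1 w2)"]
    by (subst sum.swap) simp
  then have psucc: "sw.psucc = psucc"
    by (simp add: sw.psucc_def psucc_def card_W sw.card_W mult.commute)
  have [measurable]: "cnj \<in> borel_measurable borel"
    by (intro borel_measurable_continuous_onI continuous_intros)
  have "(\<integral>z. tx1 g22 g21 g12 g11 f2 f1 w2 w1 z i * cnj (tx2 g22 g21 g12 g11 f2 f1 w2 w1 z i) \<partial>noiseM N) =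
      cnj (\<integral>z. tx1 g11 g12 g21 g22 f1 f2 w1 w2 z i * cnj (tx2 g11 g12 g21 g22 f1 f2 w1 w2 z i) \<partial>noiseM N)"
    if "i < N" for i w1 w2
  proof -
    have [measurable]: "(\<lambda>z. tx1 g22 g21 g12 g11 f2 f1 w2 w1 z i) \<in> borel_measurable (noiseM N)"
      "(\<lambda>z. tx2 g22 g21 g12 g11 f2 f1 w2 w1 z i) \<in> borel_measurable (noiseM N)"
      using that by (simp_all add: sw.measurable_tx)
    have "(\<integral>z. tx1 g22 g21 g12 g11 f2 f1 w2 w1 z i * cnj (tx2 g22 g21 g12 g11 f2 f1 w2 w1 z i) \<partial>noiseM N) =
      (\<integral>z. tx1 g22 g21 g12 g11 f2 f1 w2 w1 (swap_noise N z) i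
        * cnj (tx2 g22 g21 g12 g11 f2 f1 w2 w1 (swap_noise N z) i) \<partial>noiseM N)"
      by (subst distr_swap_noise[symmetric], subst integral_distr) auto
    also have "\<dots> = (\<integral>z. cnj (tx1 g11 g12 g21 g22 f1 f2 w1 w2 z i
        * cnj (tx2 g11 g12 g21 g22 f1 f2 w1 w2 z i)) \<partial>noiseM N)"
      using that by (simp add: tx_swap mult.commute)
    also have "\<dots> = cnj (\<integral>z. tx1 g11 g12 g21 g22 f1 f2 w1 w2 z i
        * cnj (tx2 g11 g12 g21 g22 f1 f2 w1 w2 z i) \<partial>noiseM N)"
      by (rule Bochner_Integration.integral_cnj)
    finally show ?thesis .
  qed
  then have "sw.corr = cnj corr"
    unfolding sw.corr_eq corr_eq
    by (subst sum.swap) (simp add: sw.n_def n_def mult_ac scaleR_conv_of_real)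
  then show ?thesis
    using sw.half_region_code[OF R2 R1] by (simp add: psucc)
qed

end

section \<open>Closedness of the outer region and long blocks\<close>

lemma two_powr_le_num_msgs: "2 powr (real N * R) \<le> num_msgs N R"
  unfolding num_msgs_def by (rule real_nat_ceiling_ge)

lemma num_msgs_pos: "num_msgs N R > 0"
  using two_powr_le_num_msgs[of N R] powr_gt_zero[of 2 "real N * R"] by (simp add: num_msgs_def)

lemma valid_code_half_regions:
  assumes "N > 0" "valid_code g11 g12 g21 g22 N R1 R2 f1 f2 d1 d2"
  defines "\<delta> \<equiv> 1 - err_prob g11 g12 g21 g22 N R1 R2 f1 f2 d1 d2"
  shows "\<exists>\<rho>\<in>{0..1}. half_region g11 g12 g22 \<rho> (\<delta> * R1 - 1 / N) (\<delta> * R2 - 1 / N) \<and>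
    half_region g22 g21 g11 \<rho> (\<delta> * R2 - 1 / N) (\<delta> * R1 - 1 / N)"
proof -
  interpret feedback_code g11 g12 g21 g22 f1 f2 d1 d2 N "num_msgs N R1" "num_msgs N R2"
    using assms(2) \<open>N > 0\<close> num_msgs_pos by unfold_locales (simp_all add: valid_code_def)
  have "\<delta> = psucc"
    by (simp add: \<delta>_def err_prob_def psucc_eq)
  then show ?thesis
    using half_region_code[OF two_powr_le_num_msgs two_powr_le_num_msgs]
      half_region_code_swap[OF two_powr_le_num_msgs two_powr_le_num_msgs] corr_le_1
    by (intro bexI[of _ "cmod corr"]) auto
qed

text \<open>For rho in [0,1] the arguments of all logarithms are positive, which makes the bounds
  continuous. The maps \<open>f\<close> and \<open>g\<close> allow both orders of the two
  rates.\<close>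

lemma closed_half_region:
  fixes f g :: "real \<times> real \<Rightarrow> real"
  assumes f: "continuous_on UNIV f" and g: "continuous_on UNIV g"
  shows "closed {x \<in> {0..1} \<times> UNIV. half_region a b c (fst x) (f (snd x)) (g (snd x))}"
proof -
  let ?C = "{0..1::real} \<times> (UNIV :: (real \<times> real) set)"
  have C: "closed ?C"
    by (intro closed_Times) auto
  have [continuous_intros]: "continuous_on ?C (\<lambda>x. f (snd x))" "continuous_on ?C (\<lambda>x. g (snd x))"
    by (auto intro!: continuous_on_compose2[OF f] continuous_on_compose2[OF g] continuous_intros)
  have \<tau>: "1 - (fst x)\<^sup>2 \<ge> 0" if "x \<in> ?C" for x
    using that by (auto simp: abs_square_le_1)
  have D0: "1 + (1 - (fst x)\<^sup>2) * (cmod b)\<^sup>2 > 0" if "x \<in> ?C" for x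
    using \<tau>[OF that] by (intro add_pos_nonneg) auto
  have S0: "1 + (1 - (fst x)\<^sup>2) * (cmod a)\<^sup>2 / (1 + (1 - (fst x)\<^sup>2) * (cmod b)\<^sup>2) > 0" if "x \<in> ?C" for x
    using \<tau>[OF that] D0[OF that] by (intro add_pos_nonneg) auto
  have V0: "1 + (cmod c)\<^sup>2 + (cmod b)\<^sup>2 + 2 * fst x * sqrt ((cmod c)\<^sup>2 * (cmod b)\<^sup>2) > 0" if "x \<in> ?C" for x
    using that by (intro add_pos_nonneg) auto
  have D: "\<forall>x\<in>?C. 1 + (1 - (fst x)\<^sup>2) * (cmod b)\<^sup>2 \<noteq> 0"
    using D0 by (metis less_irrefl)
  have S: "\<forall>x\<in>?C. 1 + (1 - (fst x)\<^sup>2) * (cmod a)\<^sup>2 / (1 + (1 - (fst x)\<^sup>2) * (cmod b)\<^sup>2) \<noteq> 0"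
    using S0 by (metis less_irrefl)
  have V: "\<forall>x\<in>?C. 1 + (cmod c)\<^sup>2 + (cmod b)\<^sup>2 + 2 * fst x * sqrt ((cmod c)\<^sup>2 * (cmod b)\<^sup>2) \<noteq> 0"
    using V0 by (metis less_irrefl)
  have cD: "continuous_on ?C (\<lambda>x. log 2 (1 + (1 - (fst x)\<^sup>2) * (cmod b)\<^sup>2))"
    by (intro continuous_intros D) auto
  have cS: "continuous_on ?C (\<lambda>x. log 2 (1 + (1 - (fst x)\<^sup>2) * (cmod a)\<^sup>2 / (1 + (1 - (fst x)\<^sup>2) * (cmod b)\<^sup>2)))"
    by (intro continuous_intros D S) auto
  have cV: "continuous_on ?C (\<lambda>x. log 2 (1 + (cmod c)\<^sup>2 + (cmod b)\<^sup>2 + 2 * fst x * sqrt ((cmod c)\<^sup>2 * (cmod b)\<^sup>2)))"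
    by (intro continuous_intros V) auto
  note le = continuous_on_closed_Collect_le[OF _ _ C]
  have "{x \<in> ?C. half_region a b c (fst x) (f (snd x)) (g (snd x))} =
    {x \<in> ?C. g (snd x) \<le> log 2 (1 + (cmod c)\<^sup>2 + (cmod b)\<^sup>2 + 2 * fst x * sqrt ((cmod c)\<^sup>2 * (cmod b)\<^sup>2))} \<inter>
    {x \<in> ?C. f (snd x) \<le> log 2 (1 + (1 - (fst x)\<^sup>2) * (cmod b)\<^sup>2)
       + log 2 (1 + (1 - (fst x)\<^sup>2) * (cmod a)\<^sup>2 / (1 + (1 - (fst x)\<^sup>2) * (cmod b)\<^sup>2))} \<inter>
    {x \<in> ?C. f (snd x) + g (snd x) \<le>
       log 2 (1 + (1 - (fst x)\<^sup>2) * (cmod a)\<^sup>2 / (1 + (1 - (fst x)\<^sup>2) * (cmod b)\<^sup>2))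
       + log 2 (1 + (cmod c)\<^sup>2 + (cmod b)\<^sup>2 + 2 * fst x * sqrt ((cmod c)\<^sup>2 * (cmod b)\<^sup>2))}"
    unfolding half_region_def by blast
  also have "closed \<dots>"
    by (intro closed_Int le continuous_on_add cD cS cV continuous_intros)
  finally show ?thesis .
qed

text \<open>Projecting a closed set along the compact interval of rho keeps it closed. This serves
  twice: for the limit of block lengths and for the closure in the definition of the capacity
  region.\<close>

lemma closed_outer_region:
  "closed {(R1, R2). \<exists>\<rho>\<in>{0..1}. half_region g11 g12 g22 \<rho> R1 R2 \<and> half_region g22 g21 g11 \<rho> R2 R1}"
proof -
  define T where "T = {x \<in> {0..1} \<times> UNIV. half_region g11 g12 g22 (fst x) (fst (snd x)) (snd (snd x))} \<inter>
    {x \<in> {0..1} \<times> UNIV. half_region g22 g21 g11 (fst x) (snd (snd x)) (fst (snd x))}"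
  have "closed T"
    unfolding T_def by (intro closed_Int closed_half_region continuous_intros)
  then have "closed {y. \<exists>\<rho>. \<rho> \<in> {0..1} \<and> (\<rho>, y) \<in> T}"
    by (intro closed_compact_projection) auto
  also have "{y. \<exists>\<rho>. \<rho> \<in> {0..1} \<and> (\<rho>, y) \<in> T} =
    {(R1, R2). \<exists>\<rho>\<in>{0..1}. half_region g11 g12 g22 \<rho> R1 R2 \<and> half_region g22 g21 g11 \<rho> R2 R1}"
    by (auto simp: T_def)
  finally show ?thesis .
qed

lemma fb_achievable_outer_region:
  assumes "fb_achievable g11 g12 g21 g22 R1 R2"
  shows "\<exists>\<rho>\<in>{0..1}. half_region g11 g12 g22 \<rho> R1 R2 \<and> half_region g22 g21 g11 \<rho> R2 R1"
proof -
  from assms obtain F1 F2 D1 D2 where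
    valid: "\<And>N. valid_code g11 g12 g21 g22 N R1 R2 (F1 N) (F2 N) (D1 N) (D2 N)" and
    err: "(\<lambda>N. err_prob g11 g12 g21 g22 N R1 R2 (F1 N) (F2 N) (D1 N) (D2 N)) \<longlonglongrightarrow> 0"
    unfolding fb_achievable_def by blast
  define \<delta> where "\<delta> N = 1 - err_prob g11 g12 g21 g22 N R1 R2 (F1 N) (F2 N) (D1 N) (D2 N)" for N
  \<comment> \<open>The shift by \<open>Suc\<close> skips the empty block, since the finite-length
    bounds require \<open>N > 0\<close>.\<close>
  define y where "y N = (\<delta> (Suc N) * R1 - 1 / Suc N, \<delta> (Suc N) * R2 - 1 / Suc N)" for N
  let ?R = "{(R1, R2). \<exists>\<rho>\<in>{0..1}. half_region g11 g12 g22 \<rho> R1 R2 \<and> half_region g22 g21 g11 \<rho> R2 R1}"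
  have "\<delta> \<longlonglongrightarrow> 1 - 0"
    unfolding \<delta>_def by (intro tendsto_intros err)
  then have "(\<lambda>N. \<delta> (Suc N)) \<longlonglongrightarrow> 1"
    by (simp add: LIMSEQ_Suc)
  moreover have "(\<lambda>N. 1 / real (Suc N)) \<longlonglongrightarrow> 0"
    by (rule LIMSEQ_inverse_real_of_nat[unfolded inverse_eq_divide])
  ultimately have "y \<longlonglongrightarrow> (1 * R1 - 0, 1 * R2 - 0)"
    unfolding y_def by (intro tendsto_intros)
  moreover have "y N \<in> ?R" for N
    using valid_code_half_regions[OF _ valid, of "Suc N"] by (simp add: y_def \<delta>_def)
  ultimately have "(1 * R1 - 0, 1 * R2 - 0) \<in> ?R"
    using closed_outer_region closed_sequentially by blast
  then show ?thesis by simp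
qed

theorem theorem3:
  fixes g11 g12 g21 g22 :: complex
  defines "SNR1 \<equiv> (cmod g11)^2" and "SNR2 \<equiv> (cmod g22)^2"
      and "INR12 \<equiv> (cmod g12)^2" and "INR21 \<equiv> (cmod g21)^2"
  shows "fb_capacity_region g11 g12 g21 g22 \<subseteq>
    {(R1, R2). \<exists>\<rho>\<in>{0..1::real}.
       R1 \<le> log 2 (1 + SNR1 + INR21 + 2 * \<rho> * sqrt (SNR1 * INR21)) \<and>
       R1 \<le> log 2 (1 + (1 - \<rho>^2) * INR12)
             + log 2 (1 + (1 - \<rho>^2) * SNR1 / (1 + (1 - \<rho>^2) * INR12)) \<and>
       R2 \<le> log 2 (1 + SNR2 + INR12 + 2 * \<rho> * sqrt (SNR2 * INR12)) \<and>
       R2 \<le> log 2 (1 + (1 - \<rho>^2) * INR21)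
             + log 2 (1 + (1 - \<rho>^2) * SNR2 / (1 + (1 - \<rho>^2) * INR21)) \<and>
       R1 + R2 \<le> log 2 (1 + (1 - \<rho>^2) * SNR1 / (1 + (1 - \<rho>^2) * INR12))
             + log 2 (1 + SNR2 + INR12 + 2 * \<rho> * sqrt (SNR2 * INR12)) \<and>
       R1 + R2 \<le> log 2 (1 + (1 - \<rho>^2) * SNR2 / (1 + (1 - \<rho>^2) * INR21))
             + log 2 (1 + SNR1 + INR21 + 2 * \<rho> * sqrt (SNR1 * INR21))}"
proof -
  have "fb_capacity_region g11 g12 g21 g22 \<subseteq>
    {(R1, R2). \<exists>\<rho>\<in>{0..1}. half_region g11 g12 g22 \<rho> R1 R2 \<and> half_region g22 g21 g11 \<rho> R2 R1}"
    unfolding fb_capacity_region_def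
    using fb_achievable_outer_region by (intro closure_minimal closed_outer_region) auto
  also have "\<dots> \<subseteq> {(R1, R2). \<exists>\<rho>\<in>{0..1::real}.
       R1 \<le> log 2 (1 + SNR1 + INR21 + 2 * \<rho> * sqrt (SNR1 * INR21)) \<and>
       R1 \<le> log 2 (1 + (1 - \<rho>^2) * INR12)
             + log 2 (1 + (1 - \<rho>^2) * SNR1 / (1 + (1 - \<rho>^2) * INR12)) \<and>
       R2 \<le> log 2 (1 + SNR2 + INR12 + 2 * \<rho> * sqrt (SNR2 * INR12)) \<and>
       R2 \<le> log 2 (1 + (1 - \<rho>^2) * INR21)
             + log 2 (1 + (1 - \<rho>^2) * SNR2 / (1 + (1 - \<rho>^2) * INR21)) \<and>
       R1 + R2 \<le> log 2 (1 + (1 - \<rho>^2) * SNR1 / (1 + (1 - \<rho>^2) * INR12))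
             + log 2 (1 + SNR2 + INR12 + 2 * \<rho> * sqrt (SNR2 * INR12)) \<and>
       R1 + R2 \<le> log 2 (1 + (1 - \<rho>^2) * SNR2 / (1 + (1 - \<rho>^2) * INR21))
             + log 2 (1 + SNR1 + INR21 + 2 * \<rho> * sqrt (SNR1 * INR21))}"
    \<comment> \<open>The exchanged half states its sum bound for \<open>R2 + R1\<close>, hence the
      commutativity rule.\<close>
    unfolding half_region_def SNR1_def SNR2_def INR12_def INR21_def
    by (auto simp: add.commute[of _ "_ :: real"])
  finally show ?thesis .
qed

end
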